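(* Let $X$ be a locally compact Hausdorff space. Suppose $X=\bigcup_{i=1}^\infty X_i$, where each $X_i$ is a compact subset of $X$ (with the subspace topology). (1) If $p\mathbf{DTM}(X_i)$ is dense in $\mathbf{M}(X_i)$ for every $i\in\mathbb{N}$, then $p\mathbf{DTM}(X)$ is dense in $\mathbf{M}(X)$. (2) If $p\mathbf{TM}(X_i)$ is dense in $\mathbf{M}(X_i)$ for every $i\in\mathbb{N}$, then $p\mathbf{TM}(X)$ is dense in $\mathbf{M}(X)$.
   Context: For a locally compact Hausdorff space $X$, $\mathcal{O}(X)$, $\mathcal{C}(X)$, $\mathcal{K}(X)$ are the collections of open, closed, compact subsets of $X$. A deficient topological measure on $X$ is a set function $\nu:\mathcal{C}(X)\cup\mathcal{O}(X)\to[0,\infty]$, not identically $\infty$, such that: (DTM1) $\nu(C\sqcup K)=\nu(C)+\nu(K)$ for disjoint $C,K\in\mathcal{K}(X)$; (DTM2) $\nu(U)=\sup\{\nu(C): C\subseteq U,\ C\in\mathcal{K}(X)\}$ for $U\in\mathcal{O}(X)$; (DTM3) $\nu(F)=\inf\{\nu(U): F\subseteq U,\ U\in\mathcal{O}(X)\}$ for $F\in\mathcal{C}(X)$. A topological measure is a set function $\mu:\mathcal{C}(X)\cup\mathcal{O}(X)\to[0,\infty]$, not identically $\infty$, satisfying (DTM2), (DTM3) and: if $A,B,A\sqcup B\in\mathcal{K}(X)\cup\mathcal{O}(X)$ (disjoint union) then $\mu(A\sqcup B)=\mu(A)+\mu(B)$. $\mathbf{DTM}(X)$, $\mathbf{TM}(X)$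 are the sets of finite ($\mu(X)<\infty$) deficient topological measures and finite topological measures. $\mathbf{M}(X)$ is the set of restrictions to $\mathcal{O}(X)\cup\mathcal{C}(X)$ of finite Borel measures on $X$ that are inner regular (by compact sets) on open sets and outer regular (by open sets) on all Borel sets. A deficient topological measure $\nu$ is proper if $m\le\nu$ (on $\mathcal{O}(X)\cup\mathcal{C}(X)$) with $m$ a Radon measure implies $m=0$; here a Radon measure is a Borel measure finite on compact sets, outer regular on all Borel sets and inner regular (by compact sets) on open sets. $p\mathbf{DTM}(X)$ and $p\mathbf{TM}(X)$ are the sets of proper elements of $\mathbf{DTM}(X)$ and $\mathbf{TM}(X)$. $\mathbf{DTM}(X)$ carries the weak topology: the coarsest topology making $\mu\mapsto\int_X f\,d\mu$ continuous for every $f\in C_0^+(X)$ (nonnegative continuous functions vanishing at infinity), where $\int_X f\,d\mu=\int_0^b\mu(f^{-1}((t,\infty)))\,dt$ if $f(X)\subseteq[0,b]$. "$Y$ is dense in $Z$" means $Z\subseteq\overline{Y}$ (closure in the weak topology). *)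

theory Defs
  imports "HOL-Analysis.Analysis"
begin

definition open_closed_sets :: "'a topology \<Rightarrow> 'a set set" where
  "open_closed_sets X = {A. openin X A \<or> closedin X A}"

definition deficient_topological_measure :: "'a topology \<Rightarrow> ('a set \<Rightarrow> ennreal) \<Rightarrow> bool" where
  "deficient_topological_measure X \<nu> \<longleftrightarrow>
     (\<exists>A\<in>open_closed_sets X. \<nu> A \<noteq> \<infinity>) \<and>
     (\<forall>C K. compactin X C \<longrightarrow> compactin X K \<longrightarrow> C \<inter> K = {} \<longrightarrow> \<nu> (C \<union> K) = \<nu> C + \<nu> K) \<and>
     (\<forall>U. openin X U \<longrightarrow> \<nu> U = (SUP C\<in>{C. compactin X C \<and> C \<subseteq> U}. \<nu> C)) \<and>
     (\<forall>F. closedin X F \<longrightarrow> \<nu> F = (INF U\<in>{U. openin X U \<and> F \<subseteq> U}. \<nu> U))"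

definition topological_measure :: "'a topology \<Rightarrow> ('a set \<Rightarrow> ennreal) \<Rightarrow> bool" where
  "topological_measure X \<mu> \<longleftrightarrow>
     (\<exists>A\<in>open_closed_sets X. \<mu> A \<noteq> \<infinity>) \<and>
     (\<forall>A B. compactin X A \<or> openin X A \<longrightarrow> compactin X B \<or> openin X B \<longrightarrow>
        compactin X (A \<union> B) \<or> openin X (A \<union> B) \<longrightarrow> A \<inter> B = {} \<longrightarrow>
        \<mu> (A \<union> B) = \<mu> A + \<mu> B) \<and>
     (\<forall>U. openin X U \<longrightarrow> \<mu> U = (SUP C\<in>{C. compactin X C \<and> C \<subseteq> U}. \<mu> C)) \<and>
     (\<forall>F. closedin X F \<longrightarrow> \<mu> F = (INF U\<in>{U. openin X U \<and> F \<subseteq> U}. \<mu> U))"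

text \<open>
  A set function on the open and closed subsets of \<open>X\<close> is represented by a function on all sets
  that has the fixed value \<^const>\<open>undefined\<close> elsewhere, so that distinct elements of the sets below
  are distinct set functions.
\<close>

definition DTM :: "'a topology \<Rightarrow> ('a set \<Rightarrow> ennreal) set" where
  "DTM X = {\<nu> \<in> extensional (open_closed_sets X).
              deficient_topological_measure X \<nu> \<and> \<nu> (topspace X) < \<infinity>}"

definition TM :: "'a topology \<Rightarrow> ('a set \<Rightarrow> ennreal) set" where
  "TM X = {\<mu> \<in> extensional (open_closed_sets X).
              topological_measure X \<mu> \<and> \<mu> (topspace X) < \<infinity>}"

definition regular_borel_measure :: "'a topology \<Rightarrow> 'a measure \<Rightarrow> bool" where
  "regular_borel_measure X m \<longleftrightarrow>
     space m = topspace X \<and>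
     sets m = sigma_sets (topspace X) {U. openin X U} \<and>
     (\<forall>U. openin X U \<longrightarrow>
        emeasure m U = (SUP C\<in>{C. compactin X C \<and> C \<subseteq> U}. emeasure m C)) \<and>
     (\<forall>A\<in>sets m. emeasure m A = (INF U\<in>{U. openin X U \<and> A \<subseteq> U}. emeasure m U))"

definition radon_measure :: "'a topology \<Rightarrow> 'a measure \<Rightarrow> bool" where
  "radon_measure X m \<longleftrightarrow>
     regular_borel_measure X m \<and> (\<forall>K. compactin X K \<longrightarrow> emeasure m K < \<infinity>)"

definition finite_regular_measures :: "'a topology \<Rightarrow> ('a set \<Rightarrow> ennreal) set" where
  "finite_regular_measures X =
     {restrict (emeasure m) (open_closed_sets X) | m.
        regular_borel_measure X m \<and> emeasure m (topspace X) < \<infinity>}"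

definition proper :: "'a topology \<Rightarrow> ('a set \<Rightarrow> ennreal) \<Rightarrow> bool" where
  "proper X \<nu> \<longleftrightarrow>
     (\<forall>m. radon_measure X m \<longrightarrow> (\<forall>A\<in>open_closed_sets X. emeasure m A \<le> \<nu> A) \<longrightarrow>
        (\<forall>A\<in>sets m. emeasure m A = 0))"

definition pDTM :: "'a topology \<Rightarrow> ('a set \<Rightarrow> ennreal) set" where
  "pDTM X = {\<nu> \<in> DTM X. proper X \<nu>}"

definition pTM :: "'a topology \<Rightarrow> ('a set \<Rightarrow> ennreal) set" where
  "pTM X = {\<mu> \<in> TM X. proper X \<mu>}"

definition C0_nonneg :: "'a topology \<Rightarrow> ('a \<Rightarrow> real) set" where
  "C0_nonneg X =
     {f. continuous_map X euclideanreal f \<and> (\<forall>x\<in>topspace X. 0 \<le> f x) \<and>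
         (\<forall>\<epsilon>>0. \<exists>K. compactin X K \<and> (\<forall>x\<in>topspace X - K. f x < \<epsilon>))}"

text \<open>
  The upper limit of integration is the least possible one; any \<open>b\<close> with \<open>f(X) \<subseteq> [0,b]\<close> gives the
  same value, see \<open>qintegral_eq\<close> below. For \<open>\<mu> \<in> DTM X\<close> the integrand is bounded and decreasing in \<open>t\<close>,
  hence integrable.
\<close>

definition qintegral :: "'a topology \<Rightarrow> ('a set \<Rightarrow> ennreal) \<Rightarrow> ('a \<Rightarrow> real) \<Rightarrow> real" where
  "qintegral X \<mu> f =
     (LINT t:{0..(SUP x\<in>topspace X. f x)}|lborel. enn2real (\<mu> {x\<in>topspace X. t < f x}))"

definition weak_topology :: "'a topology \<Rightarrow> ('a set \<Rightarrow> ennreal) topology" where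
  "weak_topology X =
     topology_generated_by
       {{\<mu> \<in> DTM X. qintegral X \<mu> f \<in> V} | f V. f \<in> C0_nonneg X \<and> open V}"

text \<open>Density of \<open>Y\<close> in \<open>Z\<close>; \<open>Y\<close> is not required to be a subset of \<open>Z\<close>.\<close>

definition weakly_dense_in ::
  "'a topology \<Rightarrow> ('a set \<Rightarrow> ennreal) set \<Rightarrow> ('a set \<Rightarrow> ennreal) set \<Rightarrow> bool" where
  "weakly_dense_in X Y Z \<longleftrightarrow> Z \<subseteq> weak_topology X closure_of Y"

lemma TM_subset_DTM: "TM X \<subseteq> DTM X"
proof -
  have "deficient_topological_measure X \<mu>" if "topological_measure X \<mu>" for \<mu>
    unfolding deficient_topological_measure_def
  proof (intro conjI)
    show "\<forall>C K. compactin X C \<longrightarrow> compactin X K \<longrightarrow> C \<inter> K = {} \<longrightarrow> \<mu> (C \<union> K) = \<mu> C + \<mu> K"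
      using that unfolding topological_measure_def by (meson compactin_Un)
  qed (use that in \<open>unfold topological_measure_def, blast+\<close>)
  then show ?thesis
    unfolding TM_def DTM_def by blast
qed

lemma finite_regular_measures_subset_DTM:
  assumes "Hausdorff_space X"
  shows "finite_regular_measures X \<subseteq> DTM X"
proof
  fix \<nu> assume "\<nu> \<in> finite_regular_measures X"
  then obtain m where \<nu>: "\<nu> = restrict (emeasure m) (open_closed_sets X)"
    and m: "regular_borel_measure X m" and fin: "emeasure m (topspace X) < \<infinity>"
    by (auto simp: finite_regular_measures_def)
  have sets_m: "sets m = sigma_sets (topspace X) {U. openin X U}"
    using m by (simp add: regular_borel_measure_def)
  have op: "A \<in> open_closed_sets X" "A \<in> sets m" if "openin X A" for A
    using that by (auto simp: open_closed_sets_def sets_m)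
  have cl: "A \<in> open_closed_sets X" "A \<in> sets m" if "closedin X A" for A
  proof -
    show "A \<in> open_closed_sets X"
      using that by (simp add: open_closed_sets_def)
    have "topspace X - (topspace X - A) \<in> sets m"
      unfolding sets_m using that by (intro sigma_sets.Compl sigma_sets.Basic) auto
    then show "A \<in> sets m"
      using closedin_subset[OF that] by (simp add: double_diff)
  qed
  have cp: "A \<in> open_closed_sets X" "A \<in> sets m" if "compactin X A" for A
    using cl compactin_imp_closedin[OF assms that] by auto
  have "deficient_topological_measure X \<nu>"
    unfolding deficient_topological_measure_def
  proof (intro conjI allI impI)
    show "\<exists>A\<in>open_closed_sets X. \<nu> A \<noteq> \<infinity>"
      using fin op[of "topspace X"] by (intro bexI[of _ "topspace X"]) (auto simp: \<nu>)
    show "\<nu> (C \<union> K) = \<nu> C + \<nu> K"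
      if "compactin X C" "compactin X K" "C \<inter> K = {}" for C K
      using that cp[of C] cp[of K] cp[of "C \<union> K"]
      by (simp add: \<nu> compactin_Un plus_emeasure)
    show "\<nu> U = (SUP C\<in>{C. compactin X C \<and> C \<subseteq> U}. \<nu> C)" if "openin X U" for U
      using m that op[OF that] cp by (simp add: \<nu> regular_borel_measure_def cong: SUP_cong_simp)
    show "\<nu> F = (INF U\<in>{U. openin X U \<and> F \<subseteq> U}. \<nu> U)" if "closedin X F" for F
      using m cl[OF that] op by (simp add: \<nu> regular_borel_measure_def cong: INF_cong_simp)
  qed
  then show "\<nu> \<in> DTM X"
    using fin op[of "topspace X"] by (auto simp: DTM_def \<nu>)
qed

lemma DTM_empty:
  assumes "\<nu> \<in> DTM X"
  shows "\<nu> {} = 0"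
proof -
  have dtm: "deficient_topological_measure X \<nu>" and fin: "\<nu> (topspace X) < \<infinity>"
    using assms by (auto simp: DTM_def)
  have "\<nu> (topspace X) = (SUP C\<in>{C. compactin X C \<and> C \<subseteq> topspace X}. \<nu> C)"
    using dtm by (simp add: deficient_topological_measure_def)
  moreover have "\<nu> {} \<le> (SUP C\<in>{C. compactin X C \<and> C \<subseteq> topspace X}. \<nu> C)"
    by (rule SUP_upper) auto
  ultimately have "\<nu> {} \<noteq> \<infinity>"
    using fin by auto
  moreover have "\<nu> ({} \<union> {}) = \<nu> {} + \<nu> {}"
    using dtm unfolding deficient_topological_measure_def by (metis compactin_empty inf_bot_left)
  ultimately show ?thesis
    by (cases "\<nu> {}") (auto simp flip: ennreal_plus)
qed

lemma qintegral_eq: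
  assumes \<mu>: "\<mu> \<in> DTM X" and f: "f ` topspace X \<subseteq> {0..b}"
  shows "qintegral X \<mu> f = (LINT t:{0..b}|lborel. enn2real (\<mu> {x\<in>topspace X. t < f x}))"
proof -
  let ?s = "SUP x\<in>topspace X. f x"
  have "indicator {0..?s} t *\<^sub>R enn2real (\<mu> {x\<in>topspace X. t < f x}) =
        indicator {0..b} t *\<^sub>R enn2real (\<mu> {x\<in>topspace X. t < f x})" for t
  proof (cases "{x\<in>topspace X. t < f x} = {}")
    case True
    then show ?thesis
      using DTM_empty[OF \<mu>] by (simp only: True) simp
  next
    case False
    then obtain x where x: "x \<in> topspace X" "t < f x" by auto
    have "bdd_above (f ` topspace X)"
      using f by (meson bdd_above_Icc bdd_above_mono)
    then have "f x \<le> ?s"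
      using x by (intro cSUP_upper) auto
    moreover have "f x \<le> b"
      using f x by auto
    ultimately show ?thesis
      using x by (auto simp: indicator_def)
  qed
  then show ?thesis
    unfolding qintegral_def set_lebesgue_integral_def by presburger
qed

lemma topspace_weak_topology [simp]: "topspace (weak_topology X) = DTM X"
proof -
  have "(\<lambda>_. 0) \<in> C0_nonneg X"
    unfolding C0_nonneg_def using compactin_empty by fastforce
  then have "DTM X \<in> {{\<mu> \<in> DTM X. qintegral X \<mu> f \<in> V} | f V. f \<in> C0_nonneg X \<and> open V}"
    by (intro CollectI exI[of _ "\<lambda>_. 0"] exI[of _ UNIV]) auto
  then show ?thesis
    unfolding weak_topology_def topology_generated_by_topspace by blast
qed

lemma continuous_map_qintegral:
  assumes "f \<in> C0_nonneg X"
  shows "continuous_map (weak_topology X) euclideanreal (\<lambda>\<mu>. qintegral X \<mu> f)"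
  unfolding continuous_map_def topspace_weak_topology
  using assms by (auto simp: weak_topology_def intro!: topology_generated_by_Basis)

lemma weak_topology_coarsest:
  assumes T: "topspace T = DTM X"
    and cont: "\<And>f. f \<in> C0_nonneg X \<Longrightarrow> continuous_map T euclideanreal (\<lambda>\<mu>. qintegral X \<mu> f)"
    and U: "openin (weak_topology X) U"
  shows "openin T U"
proof (rule generate_topology_on_coarsest)
  show "istopology (openin T)" by simp
  show "generate_topology_on
      {{\<mu> \<in> DTM X. qintegral X \<mu> f \<in> V} | f V. f \<in> C0_nonneg X \<and> open V} U"
    using U unfolding weak_topology_def by (rule openin_topology_generated_by)
  show "openin T S"
    if "S \<in> {{\<mu> \<in> DTM X. qintegral X \<mu> f \<in> V} | f V. f \<in> C0_nonneg X \<and> open V}" for S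
    using that cont T by (auto simp: continuous_map_def)
qed

end

theory Submission
  imports Defs
begin

text \<open>
  Let \<open>m\<close> be a finite regular measure on \<open>X\<close>. Cut \<open>X\<close> into disjoint Borel pieces \<open>B i \<subseteq> K i\<close> and drop the
  pieces from some \<open>n\<close> on: up to a small total mass, \<open>m\<close> is the sum of the measures
  \<open>A \<mapsto> m (A \<inter> B i)\<close> with \<open>i < n\<close>, each of which is a finite regular measure on the compact space \<open>K i\<close>
  (\<open>finite_regular_measure_superposition_approx\<close>). By hypothesis, each is close to a proper \<open>\<nu> i\<close> on
  \<open>K i\<close>. The candidate on \<open>X\<close> is the superposition \<open>A \<mapsto> \<Sum>i<n. \<nu> i (A \<inter> K i)\<close>. Its integrals are the
  sums of the integrals over the \<open>K i\<close>, so it is close to \<open>m\<close>. It inherits the axioms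
  of the \<open>\<nu> i\<close>, since traces on \<open>K i\<close> preserve open sets, compact sets and disjoint unions.

  The substantial point is that the superposition is proper although the \<open>K i\<close> may overlap, and for
  this properness is expressed by open covers. For a finite deficient topological measure \<open>\<nu>\<close>, let
  \<open>\<nu>* A\<close> be the infimum of \<open>\<Sum>j. \<nu> (U j)\<close> over the countable open covers of \<open>A\<close>. It is an outer measure,
  and inner regularity of \<open>\<nu>\<close> on open sets makes every closed set Caratheodory measurable
  (\<open>cover_outer_measure_closed_split\<close>). Hence, on a compact Hausdorff space, \<open>\<nu>*\<close> restricts to a Radon measure
  below \<open>\<nu>\<close>, and if \<open>\<nu>\<close> is proper then \<open>\<nu>*\<close> vanishes (\<open>proper_imp_null_cover\<close>).

  In the other direction, a summand \<open>\<nu>'\<close> with \<open>\<nu>'* = 0\<close> can be cancelled from an inequality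
  \<open>m \<le> \<nu> + \<nu>'\<close> with a Radon measure \<open>m\<close> (\<open>radon_measure_le_cancel_null_cover\<close>). Disjointify a cover
  \<open>U\<close> with small \<open>\<Sum>j. \<nu>' (U j)\<close> inside a compact set \<open>C\<close> and approximate the pieces from inside by compact
  sets \<open>E j\<close>. The \<open>E j\<close> exhaust almost all of the mass of \<open>C\<close>, the values \<open>\<nu>' (E j)\<close> have a small sum
  because \<open>E j \<subseteq> U j\<close>, and the values \<open>\<nu> (E j)\<close> have sum at most \<open>\<nu> C\<close> because the \<open>E j\<close> are disjoint.
  If a Radon measure lies below the superposition, cancelling its summands one at a time shows
  that it is zero.
\<close>

section \<open>Basic neighbourhoods in the weak topology\<close>

lemma weak_neighbourhood_contains_basic:
  assumes "openin (weak_topology X) T" and "\<mu> \<in> T"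
  obtains F \<epsilon> where "finite F" "F \<subseteq> C0_nonneg X" "\<epsilon> > 0"
    "{\<nu> \<in> DTM X. \<forall>f\<in>F. \<bar>qintegral X \<nu> f - qintegral X \<mu> f\<bar> < \<epsilon>} \<subseteq> T"
proof -
  let ?N = "\<lambda>F \<epsilon>. {\<nu> \<in> DTM X. \<forall>f\<in>F. \<bar>qintegral X \<nu> f - qintegral X \<mu> f\<bar> < (\<epsilon>::real)}"
  have "generate_topology_on
      {{\<mu> \<in> DTM X. qintegral X \<mu> f \<in> V} | f V. f \<in> C0_nonneg X \<and> open V} T"
    using assms(1) unfolding weak_topology_def by (rule openin_topology_generated_by)
  then have "\<exists>F \<epsilon>. finite F \<and> F \<subseteq> C0_nonneg X \<and> \<epsilon> > 0 \<and> ?N F \<epsilon> \<subseteq> T"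
    using assms(2)
  proof induction
    case Empty
    then show ?case by simp
  next
    case (Int a b)
    then obtain F \<epsilon> G \<delta> where "finite F" "F \<subseteq> C0_nonneg X" "\<epsilon> > 0" "?N F \<epsilon> \<subseteq> a"
      "finite G" "G \<subseteq> C0_nonneg X" "\<delta> > 0" "?N G \<delta> \<subseteq> b"
      by (meson IntE)
    moreover have "?N (F \<union> G) (min \<epsilon> \<delta>) \<subseteq> ?N F \<epsilon> \<inter> ?N G \<delta>" by auto
    ultimately show ?case
      by (intro exI[of _ "F \<union> G"] exI[of _ "min \<epsilon> \<delta>"]) auto
  next
    case (UN k)
    then show ?case by (meson UnionE Union_upper subset_trans)
  next
    case (Basis s)
    then obtain f V where s: "s = {\<nu> \<in> DTM X. qintegral X \<nu> f \<in> V}" "f \<in> C0_nonneg X" "open V"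
      by auto
    with Basis obtain \<epsilon> where "\<epsilon> > 0" "ball (qintegral X \<mu> f) \<epsilon> \<subseteq> V"
      using open_contains_ball by blast
    then show ?case
      using s by (intro exI[of _ "{f}"] exI[of _ \<epsilon>])
        (auto simp: dist_real_def abs_minus_commute subset_iff)
  qed
  then show ?thesis using that by blast
qed

lemma openin_basic_weak_neighbourhood:
  assumes "finite F" and "F \<subseteq> C0_nonneg X"
  shows "openin (weak_topology X)
    {\<nu> \<in> DTM X. \<forall>f\<in>F. \<bar>qintegral X \<nu> f - c f\<bar> < \<epsilon>}"
  using assms
proof induction
  case empty
  then show ?case using openin_topspace[of "weak_topology X"] by simp
next
  case (insert g F)
  have "openin (weak_topology X)
      {\<nu> \<in> topspace (weak_topology X). qintegral X \<nu> g \<in> ball (c g) \<epsilon>}"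
    using insert.prems by (intro openin_continuous_map_preimage[OF continuous_map_qintegral]) auto
  moreover have "{\<nu> \<in> DTM X. \<forall>f\<in>insert g F. \<bar>qintegral X \<nu> f - c f\<bar> < \<epsilon>} =
     {\<nu> \<in> topspace (weak_topology X). qintegral X \<nu> g \<in> ball (c g) \<epsilon>} \<inter>
     {\<nu> \<in> DTM X. \<forall>f\<in>F. \<bar>qintegral X \<nu> f - c f\<bar> < \<epsilon>}"
    by (auto simp: dist_real_def abs_minus_commute)
  ultimately show ?case using insert by auto
qed

text \<open>
  A neighbourhood in the weak topology constrains only finitely many integrals, so a single \<open>\<epsilon>\<close> serves for all
  of them. One element of \<open>Y\<close> has to approximate all these integrals simultaneously.
\<close>

lemma weakly_dense_in_iff:
  assumes "Z \<subseteq> DTM X"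
  shows "weakly_dense_in X Y Z \<longleftrightarrow>
    (\<forall>\<mu>\<in>Z. \<forall>F \<epsilon>. finite F \<longrightarrow> F \<subseteq> C0_nonneg X \<longrightarrow> \<epsilon> > 0 \<longrightarrow>
      (\<exists>\<nu>\<in>Y \<inter> DTM X. \<forall>f\<in>F. \<bar>qintegral X \<nu> f - qintegral X \<mu> f\<bar> < \<epsilon>))"
    (is "?L \<longleftrightarrow> ?R")
proof
  assume ?L
  show ?R
  proof (intro ballI allI impI)
    fix \<mu> F and \<epsilon> :: real
    assume *: "\<mu> \<in> Z" "finite F" "F \<subseteq> C0_nonneg X" "\<epsilon> > 0"
    let ?N = "{\<nu> \<in> DTM X. \<forall>f\<in>F. \<bar>qintegral X \<nu> f - qintegral X \<mu> f\<bar> < \<epsilon>}"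
    have "openin (weak_topology X) ?N"
      using *(2,3) by (rule openin_basic_weak_neighbourhood)
    moreover have "\<mu> \<in> ?N" using *(1,4) assms by auto
    moreover have "\<mu> \<in> weak_topology X closure_of Y"
      using \<open>?L\<close> *(1) unfolding weakly_dense_in_def by (rule subsetD)
    ultimately have "\<exists>\<nu>. \<nu> \<in> Y \<and> \<nu> \<in> ?N"
      unfolding in_closure_of by (elim conjE allE[of _ ?N]) simp
    then show "\<exists>\<nu>\<in>Y \<inter> DTM X. \<forall>f\<in>F. \<bar>qintegral X \<nu> f - qintegral X \<mu> f\<bar> < \<epsilon>" by blast
  qed
next
  assume R: ?R
  show ?L
    unfolding weakly_dense_in_def
  proof
    fix \<mu> assume "\<mu> \<in> Z"
    have "\<exists>\<nu>. \<nu> \<in> Y \<and> \<nu> \<in> T" if \<mu>T: "\<mu> \<in> T" and T: "openin (weak_topology X) T" for T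
    proof -
      obtain F \<epsilon> where "finite F" "F \<subseteq> C0_nonneg X" "\<epsilon> > 0"
        "{\<nu> \<in> DTM X. \<forall>f\<in>F. \<bar>qintegral X \<nu> f - qintegral X \<mu> f\<bar> < \<epsilon>} \<subseteq> T"
        using weak_neighbourhood_contains_basic[OF T \<mu>T] .
      then show ?thesis using R \<open>\<mu> \<in> Z\<close> by blast
    qed
    then show "\<mu> \<in> weak_topology X closure_of Y"
      using \<open>\<mu> \<in> Z\<close> assms by (auto simp: in_closure_of)
  qed
qed

section \<open>Monotonicity and additivity of deficient topological measures\<close>

text \<open>
  The axioms only evaluate the set function at open, closed and compact sets, and compact sets are closed in
  a Hausdorff space. So one may compute with the formula of a set function and restrict it to
  \<open>open_closed_sets X\<close> at the end.
\<close>

lemma measure_like_cong: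
  fixes \<nu> \<nu>' :: "'a set \<Rightarrow> ennreal"
  assumes "Hausdorff_space X" and eq: "\<And>A. A \<in> open_closed_sets X \<Longrightarrow> \<nu> A = \<nu>' A"
  shows deficient_topological_measure_cong:
      "deficient_topological_measure X \<nu> \<longleftrightarrow> deficient_topological_measure X \<nu>'"
    and topological_measure_cong: "topological_measure X \<nu> \<longleftrightarrow> topological_measure X \<nu>'"
proof -
  have op: "\<nu> A = \<nu>' A" if "openin X A" for A
    using that eq by (simp add: open_closed_sets_def)
  have cl: "\<nu> A = \<nu>' A" if "closedin X A" for A
    using that eq by (simp add: open_closed_sets_def)
  have cp: "\<nu> A = \<nu>' A" if "compactin X A" for A
    using that cl compactin_imp_closedin[OF assms(1)] by blast
  have opcp: "\<nu> A = \<nu>' A" if "compactin X A \<or> openin X A" for A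
    using that op cp by blast
  have finite_iff: "(\<exists>A\<in>open_closed_sets X. \<nu> A \<noteq> \<infinity>) \<longleftrightarrow> (\<exists>A\<in>open_closed_sets X. \<nu>' A \<noteq> \<infinity>)"
    using eq by (intro bex_cong) auto
  have inner_iff: "(\<forall>U. openin X U \<longrightarrow> \<nu> U = (SUP C\<in>{C. compactin X C \<and> C \<subseteq> U}. \<nu> C)) \<longleftrightarrow>
      (\<forall>U. openin X U \<longrightarrow> \<nu>' U = (SUP C\<in>{C. compactin X C \<and> C \<subseteq> U}. \<nu>' C))"
  proof (intro all_cong1 imp_cong refl)
    fix U assume "openin X U"
    have "(SUP C\<in>{C. compactin X C \<and> C \<subseteq> U}. \<nu> C) = (SUP C\<in>{C. compactin X C \<and> C \<subseteq> U}. \<nu>' C)"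
      using cp by (intro SUP_cong) auto
    then show "(\<nu> U = (SUP C\<in>{C. compactin X C \<and> C \<subseteq> U}. \<nu> C)) =
      (\<nu>' U = (SUP C\<in>{C. compactin X C \<and> C \<subseteq> U}. \<nu>' C))"
      by (simp only: op[OF \<open>openin X U\<close>])
  qed
  have outer_iff: "(\<forall>F. closedin X F \<longrightarrow> \<nu> F = (INF U\<in>{U. openin X U \<and> F \<subseteq> U}. \<nu> U)) \<longleftrightarrow>
      (\<forall>F. closedin X F \<longrightarrow> \<nu>' F = (INF U\<in>{U. openin X U \<and> F \<subseteq> U}. \<nu>' U))"
  proof (intro all_cong1 imp_cong refl)
    fix F assume "closedin X F"
    have "(INF U\<in>{U. openin X U \<and> F \<subseteq> U}. \<nu> U) = (INF U\<in>{U. openin X U \<and> F \<subseteq> U}. \<nu>' U)"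
      using op by (intro INF_cong) auto
    then show "(\<nu> F = (INF U\<in>{U. openin X U \<and> F \<subseteq> U}. \<nu> U)) =
      (\<nu>' F = (INF U\<in>{U. openin X U \<and> F \<subseteq> U}. \<nu>' U))"
      by (simp only: cl[OF \<open>closedin X F\<close>])
  qed
  have "(\<forall>C K. compactin X C \<longrightarrow> compactin X K \<longrightarrow> C \<inter> K = {} \<longrightarrow> \<nu> (C \<union> K) = \<nu> C + \<nu> K) \<longleftrightarrow>
      (\<forall>C K. compactin X C \<longrightarrow> compactin X K \<longrightarrow> C \<inter> K = {} \<longrightarrow> \<nu>' (C \<union> K) = \<nu>' C + \<nu>' K)"
    by (intro all_cong1 imp_cong refl) (simp only: cp compactin_Un)
  then show "deficient_topological_measure X \<nu> \<longleftrightarrow> deficient_topological_measure X \<nu>'"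
    by (simp only: deficient_topological_measure_def finite_iff inner_iff outer_iff)
  have "(\<forall>A B. compactin X A \<or> openin X A \<longrightarrow> compactin X B \<or> openin X B \<longrightarrow>
        compactin X (A \<union> B) \<or> openin X (A \<union> B) \<longrightarrow> A \<inter> B = {} \<longrightarrow> \<nu> (A \<union> B) = \<nu> A + \<nu> B) \<longleftrightarrow>
     (\<forall>A B. compactin X A \<or> openin X A \<longrightarrow> compactin X B \<or> openin X B \<longrightarrow>
        compactin X (A \<union> B) \<or> openin X (A \<union> B) \<longrightarrow> A \<inter> B = {} \<longrightarrow> \<nu>' (A \<union> B) = \<nu>' A + \<nu>' B)"
    by (intro all_cong1 imp_cong refl) (simp only: opcp)
  then show "topological_measure X \<nu> \<longleftrightarrow> topological_measure X \<nu>'"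
    by (simp only: topological_measure_def finite_iff inner_iff outer_iff)
qed

lemma restrict_in_DTM_iff:
  assumes "Hausdorff_space X"
  shows "restrict \<nu> (open_closed_sets X) \<in> DTM X \<longleftrightarrow>
    deficient_topological_measure X \<nu> \<and> \<nu> (topspace X) < \<infinity>"
  using deficient_topological_measure_cong[OF assms, of "restrict \<nu> (open_closed_sets X)" \<nu>]
  by (simp add: DTM_def open_closed_sets_def)

lemma restrict_in_TM_iff:
  assumes "Hausdorff_space X"
  shows "restrict \<nu> (open_closed_sets X) \<in> TM X \<longleftrightarrow>
    topological_measure X \<nu> \<and> \<nu> (topspace X) < \<infinity>"
  using topological_measure_cong[OF assms, of "restrict \<nu> (open_closed_sets X)" \<nu>]
  by (simp add: TM_def open_closed_sets_def)

context
  fixes X :: "'a topology" and \<nu> :: "'a set \<Rightarrow> ennreal"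
  assumes dtm: "deficient_topological_measure X \<nu>"
begin

lemma dtm_compact_Un:
  "compactin X C \<Longrightarrow> compactin X D \<Longrightarrow> C \<inter> D = {} \<Longrightarrow> \<nu> (C \<union> D) = \<nu> C + \<nu> D"
  using dtm by (simp add: deficient_topological_measure_def)

lemma dtm_open_eq_SUP: "openin X U \<Longrightarrow> \<nu> U = (SUP C\<in>{C. compactin X C \<and> C \<subseteq> U}. \<nu> C)"
  using dtm by (simp add: deficient_topological_measure_def)

lemma dtm_closed_eq_INF: "closedin X F \<Longrightarrow> \<nu> F = (INF U\<in>{U. openin X U \<and> F \<subseteq> U}. \<nu> U)"
  using dtm by (simp add: deficient_topological_measure_def)

lemma dtm_compact_le_open: "compactin X C \<Longrightarrow> openin X U \<Longrightarrow> C \<subseteq> U \<Longrightarrow> \<nu> C \<le> \<nu> U"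
  by (subst dtm_open_eq_SUP) (auto intro: SUP_upper)

lemma dtm_open_mono: "openin X U \<Longrightarrow> openin X V \<Longrightarrow> U \<subseteq> V \<Longrightarrow> \<nu> U \<le> \<nu> V"
  by (simp add: dtm_open_eq_SUP) (rule SUP_subset_mono, auto)

lemma dtm_closed_mono: "closedin X F \<Longrightarrow> closedin X G \<Longrightarrow> F \<subseteq> G \<Longrightarrow> \<nu> F \<le> \<nu> G"
  by (simp add: dtm_closed_eq_INF) (rule INF_superset_mono, auto)

text \<open>
  Superadditivity for a compact and a disjoint open set. By inner regularity it follows from additivity on
  compact sets.
\<close>

lemma dtm_compact_plus_open_le:
  assumes "compactin X C" "openin X U" "openin X W" "C \<inter> U = {}" "C \<union> U \<subseteq> W"
  shows "\<nu> C + \<nu> U \<le> \<nu> W"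
proof -
  have "\<nu> C + \<nu> U = (SUP D\<in>{D. compactin X D \<and> D \<subseteq> U}. \<nu> C + \<nu> D)"
    unfolding dtm_open_eq_SUP[OF assms(2)]
    by (rule ennreal_SUP_add_right) (use compactin_empty in blast)
  also have "\<dots> \<le> \<nu> W"
  proof (rule SUP_least)
    fix D assume "D \<in> {D. compactin X D \<and> D \<subseteq> U}"
    then have D: "compactin X D" "D \<subseteq> U" by auto
    then have "\<nu> C + \<nu> D = \<nu> (C \<union> D)" using assms by (subst dtm_compact_Un) auto
    also have "\<dots> \<le> \<nu> W" using D assms by (intro dtm_compact_le_open compactin_Un) auto
    finally show "\<nu> C + \<nu> D \<le> \<nu> W" .
  qed
  finally show ?thesis .
qed

lemma dtm_empty_of_finite:
  assumes "\<nu> (topspace X) < \<infinity>"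
  shows "\<nu> {} = 0"
proof -
  have "\<nu> {} \<le> \<nu> (topspace X)" by (rule dtm_open_mono) auto
  then have "\<nu> {} \<noteq> \<infinity>" using assms by auto
  moreover have "\<nu> {} = \<nu> {} + \<nu> {}" using dtm_compact_Un[of "{}" "{}"] by simp
  ultimately show ?thesis
    by (cases "\<nu> {}") (auto simp flip: ennreal_plus)
qed

lemma dtm_sum_disjoint_compact:
  assumes "\<nu> (topspace X) < \<infinity>" "finite I" "\<And>i. i \<in> I \<Longrightarrow> compactin X (C i)" "disjoint_family_on C I"
  shows "(\<Sum>i\<in>I. \<nu> (C i)) = \<nu> (\<Union>i\<in>I. C i)"
  using assms(2-)
proof induction
  case empty
  then show ?case using dtm_empty_of_finite[OF assms(1)] by simp
next
  case (insert i I)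
  have "disjoint_family_on C I" "C i \<inter> (\<Union>i\<in>I. C i) = {}"
    using insert by (auto simp: disjoint_family_on_def)
  moreover have "compactin X (\<Union>i\<in>I. C i)" using insert by (intro compactin_Union) auto
  ultimately show ?case using insert dtm_compact_Un[of "C i" "\<Union>i\<in>I. C i"] by simp
qed

end

section \<open>Superpositions of set functions on compact subsets\<close>

text \<open>
  For arbitrary nonempty index sets; right continuity of addition at the infimum suffices, as addition is
  monotone.
\<close>

lemma ennreal_INF_add_left:
  fixes f :: "'b \<Rightarrow> ennreal"
  assumes "I \<noteq> {}"
  shows "(INF i\<in>I. f i + c) = (INF i\<in>I. f i) + c"
  using continuous_at_Inf_mono[of "\<lambda>x. x + c" "f ` I"] assms
  using continuous_add[of "at_right (Inf (f ` I))", of "\<lambda>x. x" "\<lambda>x. c"]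
  by (auto simp: mono_def image_comp)

lemma INF_add_directed_ennreal:
  fixes f g :: "'b set \<Rightarrow> ennreal"
  assumes "\<And>C D. C \<in> S \<Longrightarrow> D \<in> S \<Longrightarrow> \<exists>E\<in>S. f E \<le> f C \<and> g E \<le> g D" "S \<noteq> {}"
  shows "(INF C\<in>S. f C) + (INF C\<in>S. g C) = (INF C\<in>S. f C + g C)"
proof (rule antisym)
  have "(INF C\<in>S. f C + g C) \<le> (INF C\<in>S. INF D\<in>S. f C + g D)"
  proof (intro INF_greatest)
    fix C D assume "C \<in> S" "D \<in> S"
    then obtain E where "E \<in> S" "f E \<le> f C" "g E \<le> g D" using assms(1) by blast
    then show "(INF C\<in>S. f C + g C) \<le> f C + g D" by (intro INF_lower2[of E] add_mono)
  qed
  also have "\<dots> = (INF C\<in>S. f C + (INF D\<in>S. g D))"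
    using ennreal_INF_add_left[OF assms(2), of g] by (intro INF_cong) (simp_all only: add.commute)
  also have "\<dots> = (INF C\<in>S. f C) + (INF D\<in>S. g D)"
    by (rule ennreal_INF_add_left[OF assms(2)])
  finally show "(INF C\<in>S. f C + g C) \<le> (INF C\<in>S. f C) + (INF C\<in>S. g C)" .
qed (intro INF_greatest add_mono INF_lower)


text \<open>
  The suprema and infima in the regularity axioms run over directed families, compact subsets under union and
  open supersets under intersection, so they commute with sums.
\<close>

lemma deficient_topological_measure_add:
  assumes \<nu>: "deficient_topological_measure X \<nu>" "\<nu> (topspace X) < \<infinity>"
    and \<nu>': "deficient_topological_measure X \<nu>'" "\<nu>' (topspace X) < \<infinity>"
    and H: "Hausdorff_space X"
  shows "deficient_topological_measure X (\<lambda>A. \<nu> A + \<nu>' A)"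
  unfolding deficient_topological_measure_def
proof (intro conjI allI impI)
  show "\<exists>A\<in>open_closed_sets X. \<nu> A + \<nu>' A \<noteq> \<infinity>"
    using \<nu>(2) \<nu>'(2) by (intro bexI[of _ "topspace X"]) (auto simp: open_closed_sets_def)
  show "\<nu> (C \<union> D) + \<nu>' (C \<union> D) = \<nu> C + \<nu>' C + (\<nu> D + \<nu>' D)"
    if "compactin X C" "compactin X D" "C \<inter> D = {}" for C D
    using that dtm_compact_Un[OF \<nu>(1)] dtm_compact_Un[OF \<nu>'(1)] by (simp add: ac_simps)
  show "\<nu> U + \<nu>' U = (SUP C\<in>{C. compactin X C \<and> C \<subseteq> U}. \<nu> C + \<nu>' C)" if "openin X U" for U
  proof -
    have mono: "\<nu> C \<le> \<nu> (C \<union> D)" "\<nu>' D \<le> \<nu>' (C \<union> D)" if "compactin X C" "compactin X D" for C D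
      using that compactin_imp_closedin[OF H] \<nu>(1) \<nu>'(1)
      by (auto intro!: dtm_closed_mono)
    show ?thesis
      unfolding dtm_open_eq_SUP[OF \<nu>(1) that] dtm_open_eq_SUP[OF \<nu>'(1) that]
    proof (rule SUP_add_directed_ennreal[symmetric])
      fix C D assume "C \<in> {C. compactin X C \<and> C \<subseteq> U}" "D \<in> {C. compactin X C \<and> C \<subseteq> U}"
      then show "\<exists>E\<in>{C. compactin X C \<and> C \<subseteq> U}. \<nu> C + \<nu>' D \<le> \<nu> E + \<nu>' E"
        using mono by (intro bexI[of _ "C \<union> D"]) (auto simp: compactin_Un intro: add_mono)
    qed
  qed
  show "\<nu> F + \<nu>' F = (INF U\<in>{U. openin X U \<and> F \<subseteq> U}. \<nu> U + \<nu>' U)" if "closedin X F" for F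
    unfolding dtm_closed_eq_INF[OF \<nu>(1) that] dtm_closed_eq_INF[OF \<nu>'(1) that]
  proof (rule INF_add_directed_ennreal)
    show "{U. openin X U \<and> F \<subseteq> U} \<noteq> {}" using closedin_subset[OF that] by auto
    fix U V assume "U \<in> {U. openin X U \<and> F \<subseteq> U}" "V \<in> {U. openin X U \<and> F \<subseteq> U}"
    then show "\<exists>W\<in>{U. openin X U \<and> F \<subseteq> U}. \<nu> W \<le> \<nu> U \<and> \<nu>' W \<le> \<nu>' V"
      by (intro bexI[of _ "U \<inter> V"]) (auto intro!: dtm_open_mono[OF \<nu>(1)] dtm_open_mono[OF \<nu>'(1)])
  qed
qed

lemma deficient_topological_measure_zero: "deficient_topological_measure X (\<lambda>_. 0)"
proof -
  have "{C. compactin X C \<and> C \<subseteq> U} \<noteq> {}" for U using compactin_empty by blast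
  moreover have "{U. openin X U \<and> F \<subseteq> U} \<noteq> {}" if "closedin X F" for F
    using closedin_subset[OF that] openin_topspace by blast
  moreover have "topspace X \<in> open_closed_sets X" by (simp add: open_closed_sets_def)
  ultimately show ?thesis unfolding deficient_topological_measure_def by auto
qed

lemma deficient_topological_measure_sum:
  assumes "finite I" and H: "Hausdorff_space X"
    and "\<And>i. i \<in> I \<Longrightarrow> deficient_topological_measure X (\<nu> i)"
    and "\<And>i. i \<in> I \<Longrightarrow> \<nu> i (topspace X) < \<infinity>"
  shows "deficient_topological_measure X (\<lambda>A. \<Sum>i\<in>I. \<nu> i A)"
  using assms(1,3,4)
proof induction
  case empty
  then show ?case by (simp add: deficient_topological_measure_zero)
next
  case (insert i I)
  then have "deficient_topological_measure X (\<lambda>A. \<nu> i A + (\<Sum>i\<in>I. \<nu> i A))"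
    using H by (intro deficient_topological_measure_add) (auto simp: less_top)
  then show ?case using insert by simp
qed

lemma compactin_subtopology_Int:
  assumes "Hausdorff_space X" "compactin X K" "compactin X C"
  shows "compactin (subtopology X K) (C \<inter> K)"
  using assms compact_Int_closedin[OF assms(3) compactin_imp_closedin[OF assms(1,2)]]
  by (simp add: compactin_subtopology)

text \<open>
  The set function on \<open>X\<close> that \<open>\<nu>\<close> induces by taking traces on \<open>K\<close>. All axioms transfer because a trace on \<open>K\<close> of
  an open or compact set is open or compact in \<open>K\<close>, and conversely every such subset of \<open>K\<close> is a trace.
\<close>

lemma deficient_topological_measure_extend:
  assumes H: "Hausdorff_space X" and K: "compactin X K"
    and \<nu>: "deficient_topological_measure (subtopology X K) \<nu>" "\<nu> K < \<infinity>"
  shows "deficient_topological_measure X (\<lambda>A. \<nu> (A \<inter> K))"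
  unfolding deficient_topological_measure_def
proof (intro conjI allI impI)
  have KX: "K \<subseteq> topspace X" using K by (rule compactin_subset_topspace)
  have clK: "closedin X K" using compactin_imp_closedin[OF H K] .
  note comp = compactin_subtopology_Int[OF H K]
  show "\<exists>A\<in>open_closed_sets X. \<nu> (A \<inter> K) \<noteq> \<infinity>"
    using \<nu>(2) KX by (intro bexI[of _ "topspace X"]) (auto simp: open_closed_sets_def Int_absorb1)
  show "\<nu> ((C \<union> D) \<inter> K) = \<nu> (C \<inter> K) + \<nu> (D \<inter> K)"
    if "compactin X C" "compactin X D" "C \<inter> D = {}" for C D
    unfolding Int_Un_distrib2 using that by (intro dtm_compact_Un[OF \<nu>(1)] comp) auto
  show "\<nu> (U \<inter> K) = (SUP C\<in>{C. compactin X C \<and> C \<subseteq> U}. \<nu> (C \<inter> K))" if "openin X U" for U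
  proof -
    have "openin (subtopology X K) (U \<inter> K)" using that by (auto simp: openin_subtopology)
    note dtm_open_eq_SUP[OF \<nu>(1) this]
    also have "(SUP C\<in>{C. compactin (subtopology X K) C \<and> C \<subseteq> U \<inter> K}. \<nu> C) =
        (SUP C\<in>{C. compactin X C \<and> C \<subseteq> U}. \<nu> (C \<inter> K))"
    proof (rule SUP_eq)
      fix C assume "C \<in> {C. compactin (subtopology X K) C \<and> C \<subseteq> U \<inter> K}"
      then show "\<exists>D\<in>{C. compactin X C \<and> C \<subseteq> U}. \<nu> C \<le> \<nu> (D \<inter> K)"
        by (intro bexI[of _ C]) (auto simp: compactin_subtopology Int_absorb2)
    next
      fix C assume "C \<in> {C. compactin X C \<and> C \<subseteq> U}"
      then show "\<exists>D\<in>{C. compactin (subtopology X K) C \<and> C \<subseteq> U \<inter> K}. \<nu> (C \<inter> K) \<le> \<nu> D"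
        using comp by (intro bexI[of _ "C \<inter> K"]) auto
    qed
    finally show ?thesis .
  qed
  show "\<nu> (F \<inter> K) = (INF U\<in>{U. openin X U \<and> F \<subseteq> U}. \<nu> (U \<inter> K))" if F: "closedin X F" for F
  proof -
    have "closedin (subtopology X K) (F \<inter> K)" using F by (auto simp: closedin_subtopology)
    note dtm_closed_eq_INF[OF \<nu>(1) this]
    also have "(INF U\<in>{U. openin (subtopology X K) U \<and> F \<inter> K \<subseteq> U}. \<nu> U) =
        (INF U\<in>{U. openin X U \<and> F \<subseteq> U}. \<nu> (U \<inter> K))"
    proof (rule INF_eq)
      fix V assume V: "V \<in> {U. openin (subtopology X K) U \<and> F \<inter> K \<subseteq> U}"
      then obtain W where W: "openin X W" "V = W \<inter> K" by (auto simp: openin_subtopology)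
      \<comment> \<open>adding the complement of K to W makes it contain F without changing its trace on K\<close>
      have "openin X (W \<union> (topspace X - K))" using W clK by auto
      moreover have "F \<subseteq> W \<union> (topspace X - K)" using V W closedin_subset[OF F] by auto
      moreover have "(W \<union> (topspace X - K)) \<inter> K = V" using W by auto
      ultimately show "\<exists>U\<in>{U. openin X U \<and> F \<subseteq> U}. \<nu> (U \<inter> K) \<le> \<nu> V"
        by (intro bexI[of _ "W \<union> (topspace X - K)"]) auto
    next
      fix U assume "U \<in> {U. openin X U \<and> F \<subseteq> U}"
      then show "\<exists>V\<in>{U. openin (subtopology X K) U \<and> F \<inter> K \<subseteq> U}. \<nu> V \<le> \<nu> (U \<inter> K)"
        by (intro bexI[of _ "U \<inter> K"]) (auto simp: openin_subtopology)
    qed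
    finally show ?thesis .
  qed
qed

definition superposition ::
  "'a topology \<Rightarrow> (nat \<Rightarrow> 'a set) \<Rightarrow> nat \<Rightarrow> (nat \<Rightarrow> 'a set \<Rightarrow> ennreal) \<Rightarrow> 'a set \<Rightarrow> ennreal" where
  "superposition X K n \<nu> = restrict (\<lambda>A. \<Sum>i<n. \<nu> i (A \<inter> K i)) (open_closed_sets X)"

lemma superposition_in_DTM:
  assumes H: "Hausdorff_space X" and K: "\<And>i. compactin X (K i)"
    and \<nu>: "\<And>i. i < n \<Longrightarrow> \<nu> i \<in> DTM (subtopology X (K i))"
  shows "superposition X K n \<nu> \<in> DTM X"
proof -
  have KX: "topspace X \<inter> K i = K i" for i using compactin_subset_topspace[OF K] by blast
  have "deficient_topological_measure (subtopology X (K i)) (\<nu> i)" "\<nu> i (K i) < \<infinity>" if "i < n" for i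
    using \<nu>[OF that] by (auto simp: DTM_def KX)
  then have "deficient_topological_measure X (\<lambda>A. \<nu> i (A \<inter> K i))" "\<nu> i (topspace X \<inter> K i) < \<infinity>"
    if "i < n" for i
    using deficient_topological_measure_extend[OF H K, of i "\<nu> i"] that by (simp_all add: KX)
  then show ?thesis
    unfolding superposition_def restrict_in_DTM_iff[OF H]
    using deficient_topological_measure_sum[OF _ H, of "{..<n}" "\<lambda>i A. \<nu> i (A \<inter> K i)"]
    by (simp add: less_top)
qed

text \<open>
  Separates the additivity axiom, the only one that still has to be checked for a superposition once it is
  known to be a deficient topological measure.
\<close>

lemma topological_measure_iff:
  "topological_measure X \<mu> \<longleftrightarrow> deficient_topological_measure X \<mu> \<and>
     (\<forall>A B. compactin X A \<or> openin X A \<longrightarrow> compactin X B \<or> openin X B \<longrightarrow>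
        compactin X (A \<union> B) \<or> openin X (A \<union> B) \<longrightarrow> A \<inter> B = {} \<longrightarrow> \<mu> (A \<union> B) = \<mu> A + \<mu> B)"
proof -
  have compact_add: "\<forall>C K. compactin X C \<longrightarrow> compactin X K \<longrightarrow> C \<inter> K = {} \<longrightarrow> \<mu> (C \<union> K) = \<mu> C + \<mu> K"
    if "\<forall>A B. compactin X A \<or> openin X A \<longrightarrow> compactin X B \<or> openin X B \<longrightarrow>
        compactin X (A \<union> B) \<or> openin X (A \<union> B) \<longrightarrow> A \<inter> B = {} \<longrightarrow> \<mu> (A \<union> B) = \<mu> A + \<mu> B"
    using that by (simp add: compactin_Un)
  show ?thesis
    unfolding topological_measure_def deficient_topological_measure_def
    by (rule iffI; elim conjE; intro conjI; (assumption | erule compact_add))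
qed

lemma superposition_in_TM:
  assumes H: "Hausdorff_space X" and K: "\<And>i. compactin X (K i)"
    and \<nu>: "\<And>i. i < n \<Longrightarrow> \<nu> i \<in> TM (subtopology X (K i))"
  shows "superposition X K n \<nu> \<in> TM X"
proof -
  let ?\<nu> = "\<lambda>A. \<Sum>i<n. \<nu> i (A \<inter> K i)"
  have "superposition X K n \<nu> \<in> DTM X"
    by (intro superposition_in_DTM[OF H K] subsetD[OF TM_subset_DTM] \<nu>)
  then have dtm: "deficient_topological_measure X ?\<nu>" "?\<nu> (topspace X) < \<infinity>"
    unfolding superposition_def restrict_in_DTM_iff[OF H] by auto
  have tr: "compactin (subtopology X (K i)) (A \<inter> K i) \<or> openin (subtopology X (K i)) (A \<inter> K i)"
    if "compactin X A \<or> openin X A" for A i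
    using that compactin_subtopology_Int[OF H K, of A] openin_subtopology_Int[of X A] by auto
  have "?\<nu> (A \<union> B) = ?\<nu> A + ?\<nu> B"
    if AB: "compactin X A \<or> openin X A" "compactin X B \<or> openin X B"
      "compactin X (A \<union> B) \<or> openin X (A \<union> B)" "A \<inter> B = {}" for A B
  proof -
    have "\<nu> i ((A \<union> B) \<inter> K i) = \<nu> i (A \<inter> K i) + \<nu> i (B \<inter> K i)" if "i < n" for i
    proof -
      have "topological_measure (subtopology X (K i)) (\<nu> i)" using \<nu>[OF that] by (simp add: TM_def)
      then have add: "\<nu> i (A' \<union> B') = \<nu> i A' + \<nu> i B'"
        if "compactin (subtopology X (K i)) A' \<or> openin (subtopology X (K i)) A'"
          "compactin (subtopology X (K i)) B' \<or> openin (subtopology X (K i)) B'"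
          "compactin (subtopology X (K i)) (A' \<union> B') \<or> openin (subtopology X (K i)) (A' \<union> B')"
          "A' \<inter> B' = {}" for A' B'
        using that unfolding topological_measure_def by blast
      have "(A \<union> B) \<inter> K i = (A \<inter> K i) \<union> (B \<inter> K i)" "(A \<inter> K i) \<inter> (B \<inter> K i) = {}"
        using AB(4) by auto
      then show ?thesis
        using tr[OF AB(1), of i] tr[OF AB(2), of i] tr[OF AB(3), of i] by (metis add)
    qed
    then show ?thesis by (simp add: sum.distrib)
  qed
  then have "topological_measure X ?\<nu>"
    unfolding topological_measure_iff using dtm(1) by blast
  then show ?thesis
    unfolding superposition_def restrict_in_TM_iff[OF H] using dtm(2) by blast
qed

section \<open>Regular Borel measures\<close>

lemma sigma_sets_openin_closedin:
  assumes "closedin X F"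
  shows "F \<in> sigma_sets (topspace X) {U. openin X U}"
proof -
  have "topspace X - (topspace X - F) \<in> sigma_sets (topspace X) {U. openin X U}"
    using assms by (intro sigma_sets.Compl sigma_sets.Basic) auto
  then show ?thesis using closedin_subset[OF assms] by (simp add: double_diff)
qed

text \<open>
  On a compact space inner regularity of open sets follows from outer regularity of their complements, since
  complements of open sets are compact. So for a finite measure only outer regularity has to be verified.
\<close>

lemma regular_borel_measure_compactI:
  assumes "compact_space X" "Hausdorff_space X"
    and sp: "space m = topspace X" and sets: "sets m = sigma_sets (topspace X) {U. openin X U}"
    and fin: "emeasure m (topspace X) < \<infinity>"
    and outer: "\<And>A \<epsilon>. A \<in> sets m \<Longrightarrow> \<epsilon> > 0 \<Longrightarrow>
      \<exists>U. openin X U \<and> A \<subseteq> U \<and> emeasure m U \<le> emeasure m A + ennreal \<epsilon>"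
  shows "regular_borel_measure X m"
  unfolding regular_borel_measure_def
proof (intro conjI allI impI ballI sp sets)
  have op: "U \<in> sets m" if "openin X U" for U using that by (auto simp: sets)
  have cl: "F \<in> sets m" if "closedin X F" for F using that by (simp add: sets sigma_sets_openin_closedin)
  have fin': "emeasure m A \<noteq> \<infinity>" for A
    using emeasure_space[of m A] fin by (auto simp: sp top_unique)
  show "emeasure m A = (INF U\<in>{U. openin X U \<and> A \<subseteq> U}. emeasure m U)" if "A \<in> sets m" for A
    using outer[OF that] op that by (intro ennreal_approx_INF) (auto intro: emeasure_mono)
  show "emeasure m U = (SUP C\<in>{C. compactin X C \<and> C \<subseteq> U}. emeasure m C)" if U: "openin X U" for U
  proof (rule ennreal_approx_SUP)
    show "emeasure m C \<le> emeasure m U" if "C \<in> {C. compactin X C \<and> C \<subseteq> U}" for C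
      using that op[OF U] by (auto intro: emeasure_mono)
    fix \<epsilon> :: real assume "\<epsilon> > 0"
    have cU: "closedin X (topspace X - U)" using U by blast
    obtain V where V: "openin X V" "topspace X - U \<subseteq> V"
      "emeasure m V \<le> emeasure m (topspace X - U) + ennreal \<epsilon>"
      using outer[OF cl[OF cU] \<open>\<epsilon> > 0\<close>] by blast
    let ?C = "topspace X - V"
    have C: "compactin X ?C" "?C \<subseteq> U" "?C \<in> sets m"
      using V(1,2) assms(1) closedin_compact_space[OF assms(1), of ?C] cl[of ?C] by auto
    have "emeasure m U = emeasure m ?C + emeasure m (U - ?C)"
      using C op[OF U] by (subst plus_emeasure) (auto intro!: arg_cong[of _ _ "emeasure m"])
    moreover have "emeasure m V = emeasure m (topspace X - U) + emeasure m (U - ?C)"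
      using V openin_subset[OF U] openin_subset[OF V(1)] C op[OF U] cl[OF cU]
      by (subst plus_emeasure) (auto intro!: arg_cong[of _ _ "emeasure m"])
    then have "emeasure m (U - ?C) \<le> ennreal \<epsilon>"
      using V(3) fin'[of "topspace X - U"] by (simp add: ennreal_add_left_cancel_le)
    ultimately have "emeasure m U \<le> emeasure m ?C + ennreal \<epsilon>"
      by (simp add: add_left_mono)
    then show "\<exists>C\<in>{C. compactin X C \<and> C \<subseteq> U}. emeasure m U \<le> emeasure m C + ennreal \<epsilon>"
      using C by blast
  qed
qed

lemma radon_measure_sets:
  assumes "Hausdorff_space X" and m: "radon_measure X m"
  shows "openin X A \<Longrightarrow> A \<in> sets m" and "closedin X A \<Longrightarrow> A \<in> sets m"
    and "compactin X A \<Longrightarrow> A \<in> sets m"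
proof -
  have s: "sets m = sigma_sets (topspace X) {U. openin X U}"
    using m by (simp add: radon_measure_def regular_borel_measure_def)
  show "openin X A \<Longrightarrow> A \<in> sets m" unfolding s by (auto intro: sigma_sets.Basic)
  show cl: "closedin X A \<Longrightarrow> A \<in> sets m" unfolding s by (rule sigma_sets_openin_closedin)
  show "compactin X A \<Longrightarrow> A \<in> sets m" by (rule cl[OF compactin_imp_closedin[OF assms(1)]])
qed

text \<open>
  Inside a compact set \<open>C\<close>, where the measure is finite, inner regularity extends from open to Borel sets: an
  open set that covers \<open>C - D\<close> with little excess leaves a compact subset of \<open>D\<close>.
\<close>

lemma radon_measure_inner_compact:
  assumes H: "Hausdorff_space X" and m: "radon_measure X m"
    and D: "D \<in> sets m" "D \<subseteq> C" and C: "compactin X C" and "\<epsilon> > (0::real)"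
  shows "\<exists>E. compactin X E \<and> E \<subseteq> D \<and> emeasure m D \<le> emeasure m E + ennreal \<epsilon>"
proof -
  have Cm: "C \<in> sets m" using radon_measure_sets(3)[OF H m C] .
  have "emeasure m (C - D) \<le> emeasure m C" using Cm by (intro emeasure_mono) auto
  then have fin: "emeasure m (C - D) \<noteq> \<infinity>" using m C unfolding radon_measure_def by fastforce
  have "emeasure m (C - D) = (INF U\<in>{U. openin X U \<and> C - D \<subseteq> U}. emeasure m U)"
    using m Cm D(1) unfolding radon_measure_def regular_borel_measure_def by blast
  from INF_approx_ennreal[OF \<open>\<epsilon> > 0\<close> this fin]
  obtain V where V: "openin X V" "C - D \<subseteq> V" "emeasure m V < emeasure m (C - D) + ennreal \<epsilon>"
    by blast
  have Vm: "V \<in> sets m" using radon_measure_sets(1)[OF H m V(1)] .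
  let ?E = "C - V"
  have "?E = C \<inter> (topspace X - V)" using compactin_subset_topspace[OF C] by auto
  then have E: "compactin X ?E" using compact_Int_closedin[OF C openin_closedin_eq[THEN iffD1, OF V(1), THEN conjunct2]] by simp
  have ED: "?E \<subseteq> D" using V(2) by auto
  have "emeasure m V = emeasure m (V - (C - D)) + emeasure m (C - D)"
    using V(2) Vm Cm D by (subst plus_emeasure) (auto intro!: arg_cong[of _ _ "emeasure m"])
  then have "emeasure m (V - (C - D)) \<le> ennreal \<epsilon>"
    using V(3) fin by (metis add.commute ennreal_add_left_cancel_less infinity_ennreal_def less_imp_le)
  moreover have "emeasure m (D - ?E) \<le> emeasure m (V - (C - D))"
    using D Vm Cm by (intro emeasure_mono) auto
  moreover have "emeasure m D = emeasure m ?E + emeasure m (D - ?E)"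
    using ED D(1) Cm Vm by (subst plus_emeasure) (auto intro!: arg_cong[of _ _ "emeasure m"])
  ultimately have "emeasure m D \<le> emeasure m ?E + ennreal \<epsilon>"
    by (simp add: add_left_mono)
  then show ?thesis using E ED by blast
qed

text \<open>
  The piece of \<open>m\<close> carried by a Borel set \<open>B \<subseteq> K\<close>, as a regular measure on the space \<open>K\<close>. It stays regular because
  an open set \<open>V \<supseteq> A\<close> with small \<open>m (V - A)\<close> has no larger excess after intersection with \<open>B\<close>.
\<close>

lemma restrict_to_compact_in_finite_regular_measures:
  assumes H: "Hausdorff_space X" and K: "compactin X K"
    and m: "regular_borel_measure X m" "emeasure m (topspace X) < \<infinity>"
    and B: "B \<in> sets m" "B \<subseteq> K"
  shows "restrict (\<lambda>A. emeasure m (A \<inter> B)) (open_closed_sets (subtopology X K))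
    \<in> finite_regular_measures (subtopology X K)"
proof -
  \<comment> \<open>B may be any Borel set, so the density carries the piece and the restriction only changes the underlying space\<close>
  define m' where "m' = restrict_space (density m (indicator B)) K"
  have KX: "topspace (subtopology X K) = K" using compactin_subset_topspace[OF K] by auto
  have sp: "space m = topspace X" and sets: "sets m = sigma_sets (topspace X) {U. openin X U}"
    using m(1) by (auto simp: regular_borel_measure_def)
  have fin: "emeasure m A \<noteq> \<infinity>" for A
    using emeasure_space[of m A] m(2) by (auto simp: sp top_unique)
  have Km: "K \<in> sets m"
    unfolding sets by (rule sigma_sets_openin_closedin[OF compactin_imp_closedin[OF H K]])
  have KmB: "K \<inter> space (density m (indicator B)) \<in> sets (density m (indicator B))"
    using Km by (simp add: sp Int_absorb2 compactin_subset_topspace[OF K])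
  have sets': "A \<in> sets m' \<longleftrightarrow> A \<subseteq> K \<and> A \<in> sets m" for A
    unfolding m'_def sets_restrict_space_iff[OF KmB] by simp
  have em: "emeasure m' A = emeasure m (A \<inter> B)" if "A \<in> sets m'" for A
    using that B Km KmB unfolding sets'
    by (simp add: m'_def emeasure_restrict_space emeasure_restricted Int_commute)
  have sp': "space m' = topspace (subtopology X K)"
    using compactin_subset_topspace[OF K] by (auto simp: m'_def space_restrict_space sp)
  have sets_m': "sets m' = sigma_sets (topspace (subtopology X K)) {U. openin (subtopology X K) U}"
  proof -
    have "sets m' = (\<inter>) K ` sigma_sets (topspace X) {U. openin X U}"
      by (simp add: m'_def sets_restrict_space sets)
    also have "\<dots> = sigma_sets K ((\<inter>) K ` {U. openin X U})"
      using Km by (intro sigma_sets_Int) (auto simp: sets compactin_subset_topspace[OF K])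
    also have "(\<inter>) K ` {U. openin X U} = {U. openin (subtopology X K) U}"
      by (auto simp: openin_subtopology Int_commute)
    finally show ?thesis by (simp only: KX)
  qed
  have top': "topspace (subtopology X K) \<in> sets m'" using Km unfolding KX sets' by simp
  have "regular_borel_measure (subtopology X K) m'"
  proof (rule regular_borel_measure_compactI[OF _ _ sp' sets_m'])
    show "compact_space (subtopology X K)" using K by (rule compact_space_subtopology)
    show "Hausdorff_space (subtopology X K)" using H by (rule Hausdorff_space_subtopology)
    show "emeasure m' (topspace (subtopology X K)) < \<infinity>"
      using em[OF top'] fin by (simp add: less_top)
    fix A and \<epsilon> :: real assume "A \<in> sets m'" "\<epsilon> > 0"
    then have A: "A \<subseteq> K" "A \<in> sets m" by (auto simp: sets')
    have "emeasure m A = (INF U\<in>{U. openin X U \<and> A \<subseteq> U}. emeasure m U)"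
      using m(1) A(2) unfolding regular_borel_measure_def by blast
    from INF_approx_ennreal[OF \<open>\<epsilon> > 0\<close> this fin]
    obtain V where V: "openin X V" "A \<subseteq> V" "emeasure m V < emeasure m A + ennreal \<epsilon>" by blast
    have Vm: "V \<in> sets m" using V(1) by (auto simp: sets)
    have "emeasure m V = emeasure m A + emeasure m (V - A)"
      using V(2) Vm A(2) by (subst plus_emeasure) (auto intro!: arg_cong[of _ _ "emeasure m"])
    then have VA: "emeasure m (V - A) \<le> ennreal \<epsilon>"
      using V(3) fin[of A] by (metis ennreal_add_left_cancel_less infinity_ennreal_def less_imp_le)
    have "emeasure m ((V \<inter> K) \<inter> B) \<le> emeasure m ((A \<inter> B) \<union> (V - A))"
      using A(2) B(1) Vm by (intro emeasure_mono) auto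
    also have "\<dots> \<le> emeasure m (A \<inter> B) + emeasure m (V - A)"
      using A(2) B(1) Vm by (intro emeasure_subadditive) auto
    also have "\<dots> \<le> emeasure m (A \<inter> B) + ennreal \<epsilon>" using VA by (rule add_left_mono)
    finally have "emeasure m ((V \<inter> K) \<inter> B) \<le> emeasure m (A \<inter> B) + ennreal \<epsilon>" .
    moreover have "V \<inter> K \<in> sets m'" using Vm Km by (auto simp: sets')
    ultimately show "\<exists>U. openin (subtopology X K) U \<and> A \<subseteq> U \<and> emeasure m' U \<le> emeasure m' A + ennreal \<epsilon>"
      using V A em[OF \<open>A \<in> sets m'\<close>] em[of "V \<inter> K"]
      by (intro exI[of _ "V \<inter> K"]) (auto simp: openin_subtopology)
  qed
  moreover have "emeasure m' (topspace (subtopology X K)) < \<infinity>"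
    using em[OF top'] fin by (simp add: less_top)
  moreover have "restrict (\<lambda>A. emeasure m (A \<inter> B)) (open_closed_sets (subtopology X K)) =
      restrict (emeasure m') (open_closed_sets (subtopology X K))"
  proof (rule restrict_ext)
    fix A assume "A \<in> open_closed_sets (subtopology X K)"
    then have "A \<in> sets m'"
      unfolding sets_m' open_closed_sets_def 
      by (auto simp del: topspace_subtopology intro: sigma_sets_openin_closedin)
    then show "emeasure m (A \<inter> B) = emeasure m' A" by (simp add: em)
  qed
  ultimately show ?thesis unfolding finite_regular_measures_def by blast
qed

section \<open>The outer measure of open covers\<close>

definition cover_outer_measure :: "'a topology \<Rightarrow> ('a set \<Rightarrow> ennreal) \<Rightarrow> 'a set \<Rightarrow> ennreal" where
  "cover_outer_measure X \<nu> A =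
     (INF U\<in>{U. (\<forall>j::nat. openin X (U j)) \<and> A \<subseteq> (\<Union>j. U j)}. \<Sum>j. \<nu> (U j))"

lemma cover_outer_measure_le:
  "(\<And>j. openin X (U j)) \<Longrightarrow> A \<subseteq> (\<Union>j. U j) \<Longrightarrow> cover_outer_measure X \<nu> A \<le> (\<Sum>j. \<nu> (U j))"
  unfolding cover_outer_measure_def by (rule INF_lower) simp

lemma cover_outer_measure_mono:
  "A \<subseteq> B \<Longrightarrow> cover_outer_measure X \<nu> A \<le> cover_outer_measure X \<nu> B"
  unfolding cover_outer_measure_def by (rule INF_superset_mono) auto

lemma cover_outer_measure_le_open:
  assumes "openin X U" "\<nu> {} = 0"
  shows "cover_outer_measure X \<nu> U \<le> \<nu> U"
proof -
  have "cover_outer_measure X \<nu> U \<le> (\<Sum>j. \<nu> (if j = (0::nat) then U else {}))"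
    using assms by (intro cover_outer_measure_le) auto
  also have "\<dots> = (\<Sum>j\<in>{0}. \<nu> (if j = (0::nat) then U else {}))"
    using assms by (intro suminf_finite) auto
  finally show ?thesis by simp
qed

lemma cover_outer_measure_less_iff:
  "cover_outer_measure X \<nu> A < c \<longleftrightarrow>
    (\<exists>U::nat \<Rightarrow> 'a set. (\<forall>j. openin X (U j)) \<and> A \<subseteq> (\<Union>j. U j) \<and> (\<Sum>j. \<nu> (U j)) < c)"
  for X :: "'a topology"
  unfolding cover_outer_measure_def INF_less_iff by simp

text \<open>
  For the usual distribution of an error \<open>\<epsilon>\<close> over countably many approximations.
\<close>

lemma suminf_add_geometric:
  fixes f :: "nat \<Rightarrow> ennreal"
  assumes "\<epsilon> \<ge> 0"
  shows "(\<Sum>n. f n + ennreal (\<epsilon> * (1/2) ^ Suc n)) = (\<Sum>n. f n) + ennreal \<epsilon>"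
proof -
  have "(\<lambda>n. \<epsilon> * (1/2) ^ Suc n) sums (\<epsilon> * 1)" by (intro sums_mult power_half_series)
  then have "(\<Sum>n. ennreal (\<epsilon> * (1/2) ^ Suc n)) = ennreal \<epsilon>"
    using assms by (intro suminf_ennreal_eq) auto
  moreover have "(\<Sum>n. f n + ennreal (\<epsilon> * (1/2) ^ Suc n)) =
      (\<Sum>n. f n) + (\<Sum>n. ennreal (\<epsilon> * (1/2) ^ Suc n))"
    by (intro suminf_add[symmetric]) auto
  ultimately show ?thesis by simp
qed

lemma cover_outer_measure_countably_subadditive:
  fixes A :: "nat \<Rightarrow> 'a set"
  shows "cover_outer_measure X \<nu> (\<Union>i. A i) \<le> (\<Sum>i. cover_outer_measure X \<nu> (A i))"
proof (rule ennreal_le_epsilon)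
  let ?O = "cover_outer_measure X \<nu>"
  fix \<epsilon> :: real assume "\<epsilon> > 0" and fin: "(\<Sum>i. ?O (A i)) < top"
  have "?O (A i) < ?O (A i) + ennreal (\<epsilon> * (1/2) ^ Suc i)" for i
    using \<open>\<epsilon> > 0\<close> ennreal_suminf_lessD[OF fin, of i] by (simp add: less_top)
  then have "\<exists>U :: nat \<Rightarrow> 'a set. (\<forall>j. openin X (U j)) \<and> A i \<subseteq> (\<Union>j. U j) \<and>
      (\<Sum>j. \<nu> (U j)) < ?O (A i) + ennreal (\<epsilon> * (1/2) ^ Suc i)" for i
    unfolding cover_outer_measure_less_iff .
  then obtain U :: "nat \<Rightarrow> nat \<Rightarrow> 'a set" where U: "\<And>i j. openin X (U i j)" "\<And>i. A i \<subseteq> (\<Union>j. U i j)"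
    "\<And>i. (\<Sum>j. \<nu> (U i j)) < ?O (A i) + ennreal (\<epsilon> * (1/2) ^ Suc i)"
    by metis
  \<comment> \<open>all the covers in a single sequence\<close>
  let ?V = "\<lambda>k. case_prod U (prod_decode k)"
  have "(\<Union>i. A i) \<subseteq> (\<Union>k. ?V k)"
  proof
    fix x assume "x \<in> (\<Union>i. A i)"
    then obtain i j where "x \<in> U i j" using U(2) by blast
    then have "x \<in> ?V (prod_encode (i, j))" by simp
    then show "x \<in> (\<Union>k. ?V k)" by (rule UN_I[OF UNIV_I])
  qed
  then have "?O (\<Union>i. A i) \<le> (\<Sum>k. \<nu> (?V k))"
    using U(1) by (intro cover_outer_measure_le) (simp add: case_prod_beta)
  also have "\<dots> = (\<Sum>i. \<Sum>j. \<nu> (U i j))"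
    using suminf_ennreal_2dimen[of "\<lambda>i. \<Sum>j. \<nu> (U i j)" "\<lambda>p. \<nu> (case_prod U p)"] by simp
  also have "\<dots> \<le> (\<Sum>i. ?O (A i) + ennreal (\<epsilon> * (1/2) ^ Suc i))"
    using U(3) by (intro suminf_le less_imp_le) auto
  also have "\<dots> = (\<Sum>i. ?O (A i)) + ennreal \<epsilon>"
    using \<open>\<epsilon> > 0\<close> by (intro suminf_add_geometric) simp
  finally show "?O (\<Union>i. A i) \<le> (\<Sum>i. ?O (A i)) + ennreal \<epsilon>" .
qed

text \<open>
  Caratheodory measurability of closed sets. Given a cover \<open>U\<close> of \<open>A\<close>, choose compact sets \<open>C j \<subseteq> U j - F\<close> that
  carry almost all of \<open>\<nu> (U j - F)\<close>. Then the open sets \<open>U j - F\<close> cover \<open>A - F\<close>, the open sets \<open>U j - C j\<close> cover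
  \<open>A \<inter> F\<close>, and superadditivity gives \<open>\<nu> (C j) + \<nu> (U j - C j) \<le> \<nu> (U j)\<close>.
\<close>

lemma cover_outer_measure_closed_split:
  assumes H: "Hausdorff_space X" and \<nu>: "deficient_topological_measure X \<nu>"
    and fin: "\<nu> (topspace X) < \<infinity>" and F: "closedin X F"
  shows "cover_outer_measure X \<nu> (A \<inter> F) + cover_outer_measure X \<nu> (A - F) \<le> cover_outer_measure X \<nu> A"
proof (rule ennreal_le_epsilon)
  let ?O = "cover_outer_measure X \<nu>"
  fix \<epsilon> :: real assume "\<epsilon> > 0" and finA: "?O A < top"
  then have "?O A < ?O A + ennreal (\<epsilon>/2)" by (simp add: less_top)
  then obtain U :: "nat \<Rightarrow> 'a set" where U: "\<And>j. openin X (U j)" "A \<subseteq> (\<Union>j. U j)"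
      "(\<Sum>j. \<nu> (U j)) < ?O A + ennreal (\<epsilon>/2)"
    unfolding cover_outer_measure_less_iff by blast
  have UF: "openin X (U j - F)" for j using U(1) F by (rule openin_diff)
  have "\<exists>C. compactin X C \<and> C \<subseteq> U j - F \<and> \<nu> (U j - F) \<le> \<nu> C + ennreal (\<epsilon>/2 * (1/2) ^ Suc j)" for j
  proof -
    have "\<nu> (U j - F) \<noteq> \<infinity>"
      using dtm_open_mono[OF \<nu> UF openin_topspace openin_subset[OF UF], of j] fin by (auto simp: top_unique)
    then have "\<exists>C\<in>{C. compactin X C \<and> C \<subseteq> U j - F}. \<nu> (U j - F) < \<nu> C + ennreal (\<epsilon>/2 * (1/2) ^ Suc j)"
      using \<open>\<epsilon> > 0\<close> compactin_empty
      by (intro SUP_approx_ennreal[OF _ _ dtm_open_eq_SUP[OF \<nu> UF]]) auto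
    then show ?thesis by (auto intro: less_imp_le)
  qed
  then obtain C where C: "\<And>j. compactin X (C j)" "\<And>j. C j \<subseteq> U j - F"
      "\<And>j. \<nu> (U j - F) \<le> \<nu> (C j) + ennreal (\<epsilon>/2 * (1/2) ^ Suc j)"
    by metis
  have UC: "openin X (U j - C j)" for j
    using U(1) compactin_imp_closedin[OF H C(1)] by (rule openin_diff)
  have "A \<inter> F \<subseteq> (\<Union>j. U j - C j)" using U(2) C(2) by blast
  then have "?O (A \<inter> F) \<le> (\<Sum>j. \<nu> (U j - C j))"
    by (rule cover_outer_measure_le[OF UC])
  moreover have "A - F \<subseteq> (\<Union>j. U j - F)" using U(2) by blast
  then have "?O (A - F) \<le> (\<Sum>j. \<nu> (U j - F))"
    by (rule cover_outer_measure_le[OF UF])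
  ultimately have "?O (A \<inter> F) + ?O (A - F) \<le> (\<Sum>j. \<nu> (U j - C j)) + (\<Sum>j. \<nu> (U j - F))"
    by (rule add_mono)
  also have "\<dots> = (\<Sum>j. \<nu> (U j - C j) + \<nu> (U j - F))" by (intro suminf_add) auto
  also have "\<dots> \<le> (\<Sum>j. \<nu> (U j) + ennreal (\<epsilon>/2 * (1/2) ^ Suc j))"
  proof (intro suminf_le)
    fix j
    have "\<nu> (C j) + \<nu> (U j - C j) \<le> \<nu> (U j)"
      using C(2)[of j] by (intro dtm_compact_plus_open_le[OF \<nu> C(1) UC U(1)]) auto
    then have "\<nu> (U j - C j) + (\<nu> (C j) + ennreal (\<epsilon>/2 * (1/2) ^ Suc j)) \<le> \<nu> (U j) + ennreal (\<epsilon>/2 * (1/2) ^ Suc j)"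
      by (metis add.assoc add.commute add_right_mono)
    then show "\<nu> (U j - C j) + \<nu> (U j - F) \<le> \<nu> (U j) + ennreal (\<epsilon>/2 * (1/2) ^ Suc j)"
      using add_left_mono[OF C(3)] order_trans by blast
  qed auto
  also have "\<dots> = (\<Sum>j. \<nu> (U j)) + ennreal (\<epsilon>/2)"
    using \<open>\<epsilon> > 0\<close> by (intro suminf_add_geometric) simp
  also have "\<dots> \<le> ?O A + ennreal (\<epsilon>/2) + ennreal (\<epsilon>/2)"
    using U(3) by (intro add_right_mono less_imp_le)
  also have "\<dots> = ?O A + ennreal \<epsilon>"
    using \<open>\<epsilon> > 0\<close> by (simp add: add.assoc flip: ennreal_plus)
  finally show "?O (A \<inter> F) + ?O (A - F) \<le> ?O A + ennreal \<epsilon>" .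
qed

lemma measure_space_cover_outer_measure:
  assumes H: "Hausdorff_space X" and \<nu>: "deficient_topological_measure X \<nu>"
    and fin: "\<nu> (topspace X) < \<infinity>"
  shows "measure_space (topspace X) (sigma_sets (topspace X) {U. openin X U}) (cover_outer_measure X \<nu>)"
proof -
  let ?O = "cover_outer_measure X \<nu>" and ?\<Omega> = "topspace X"
  let ?L = "lambda_system ?\<Omega> (Pow ?\<Omega>) ?O"
  have "?O {} = 0"
    using cover_outer_measure_le_open[of X "{}" \<nu>] dtm_empty_of_finite[OF \<nu> fin] by simp
  moreover have subadd: "?O (A \<union> B) \<le> ?O A + ?O B" for A B
  proof -
    have "?O (A \<union> B) \<le> (\<Sum>i. ?O (binaryset A B i))"
      using cover_outer_measure_countably_subadditive[of X \<nu> "binaryset A B"] by (simp add: UN_binaryset_eq)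
    also have "\<dots> = ?O A + ?O B"
      using \<open>?O {} = 0\<close> by (simp add: suminf_binaryset_eq)
    finally show ?thesis .
  qed
  ultimately have "outer_measure_space (Pow ?\<Omega>) ?O"
    unfolding outer_measure_space_def positive_def increasing_def countably_subadditive_def
    by (auto intro: cover_outer_measure_mono cover_outer_measure_countably_subadditive)
  then have L: "measure_space ?\<Omega> ?L ?O"
    by (rule sigma_algebra.caratheodory_lemma[OF sigma_algebra_Pow])
  have "U \<in> ?L" if "openin X U" for U
  proof -
    have "?O (A \<inter> U) + ?O (A - U) = ?O A" if "A \<subseteq> ?\<Omega>" for A
    proof (rule antisym)
      have "A \<inter> (?\<Omega> - U) = A - U" "A - (?\<Omega> - U) = A \<inter> U" using that by auto
      then show "?O (A \<inter> U) + ?O (A - U) \<le> ?O A"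
        using cover_outer_measure_closed_split[OF H \<nu> fin, of "?\<Omega> - U" A] openin_closedin_eq[of X U] \<open>openin X U\<close>
        by (simp add: add.commute)
      show "?O A \<le> ?O (A \<inter> U) + ?O (A - U)"
        using subadd[of "A \<inter> U" "A - U"] by (simp add: Int_Diff_Un)
    qed
    then show ?thesis
      using openin_subset[OF that] by (simp add: algebra.lambda_system_eq[OF algebra_Pow])
  qed
  then have "sigma_sets ?\<Omega> {U. openin X U} \<subseteq> ?L"
    using L by (intro sigma_algebra.sigma_sets_subset) (auto simp: measure_space_def)
  moreover have "sigma_algebra ?\<Omega> (sigma_sets ?\<Omega> {U. openin X U})"
    by (intro sigma_algebra_sigma_sets) (auto dest: openin_subset)
  ultimately show ?thesis using L by (metis measure_down)
qed

text \<open>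
  The cover outer measure restricts to a Radon measure: it is outer regular by construction, and on a compact
  space this is enough. It lies below \<open>\<nu>\<close>, since an open set covers itself and \<open>\<nu>\<close> is outer regular on closed
  sets. So it vanishes when \<open>\<nu>\<close> is proper.
\<close>

lemma proper_imp_null_cover:
  assumes X: "compact_space X" "Hausdorff_space X"
    and \<nu>: "deficient_topological_measure X \<nu>" "\<nu> (topspace X) < \<infinity>" and "proper X \<nu>"
  shows "cover_outer_measure X \<nu> (topspace X) = 0"
proof -
  let ?O = "cover_outer_measure X \<nu>" and ?B = "sigma_sets (topspace X) {U. openin X U}"
  define m where "m = measure_of (topspace X) ?B ?O"
  have B: "?B \<subseteq> Pow (topspace X)"
    by (auto dest: openin_subset sigma_sets_into_sp[rotated])
  have sigma: "sigma_algebra (topspace X) ?B"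
    by (intro sigma_algebra_sigma_sets) (auto dest: openin_subset)
  have sp: "space m = topspace X" and sets: "sets m = ?B"
    using B sigma_algebra.sigma_sets_eq[OF sigma] by (simp_all add: m_def space_measure_of sets_measure_of)
  have em: "emeasure m A = ?O A" if "A \<in> ?B" for A
    using measure_space_cover_outer_measure[OF X(2) \<nu>] that unfolding m_def
    by (intro emeasure_measure_of_sigma) (auto simp: measure_space_def sigma)
  have op: "U \<in> ?B" if "openin X U" for U using that by auto
  have O_le: "?O U \<le> \<nu> U" if "openin X U" for U
    using cover_outer_measure_le_open[OF that] dtm_empty_of_finite[OF \<nu>] by blast
  have fin: "emeasure m (topspace X) < \<infinity>"
    using em[OF op] O_le[of "topspace X"] \<nu>(2) by (auto intro: le_less_trans)
  have "regular_borel_measure X m"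
  proof (rule regular_borel_measure_compactI[OF X sp sets fin])
    fix A and \<epsilon> :: real assume A: "A \<in> sets m" and "\<epsilon> > 0"
    have "?O A \<le> ?O (topspace X)"
      using A B by (intro cover_outer_measure_mono) (auto simp: sets)
    then have "?O A < ?O A + ennreal \<epsilon>"
      using fin em[OF op] \<open>\<epsilon> > 0\<close> by (auto simp: less_top intro: le_less_trans)
    then obtain U :: "nat \<Rightarrow> 'a set" where U: "\<And>j. openin X (U j)" "A \<subseteq> (\<Union>j. U j)"
        "(\<Sum>j. \<nu> (U j)) < ?O A + ennreal \<epsilon>"
      unfolding cover_outer_measure_less_iff by blast
    have oU: "openin X (\<Union>j. U j)" using U(1) by blast
    have "emeasure m (\<Union>j. U j) \<le> (\<Sum>j. \<nu> (U j))"
      using em[OF op[OF oU]] U(1) by (simp add: cover_outer_measure_le)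
    then show "\<exists>V. openin X V \<and> A \<subseteq> V \<and> emeasure m V \<le> emeasure m A + ennreal \<epsilon>"
      using oU U(2,3) em A by (intro exI[of _ "\<Union>j. U j"]) (auto simp: sets)
  qed
  moreover have "emeasure m A < \<infinity>" for A
    using emeasure_space[of m A] fin by (auto simp: sp intro: le_less_trans)
  ultimately have radon: "radon_measure X m" by (simp add: radon_measure_def)
  have "emeasure m A \<le> \<nu> A" if "A \<in> open_closed_sets X" for A
  proof (cases "openin X A")
    case True
    then show ?thesis using em[OF op] O_le by simp
  next
    case False
    then have A: "closedin X A" using that by (simp add: open_closed_sets_def)
    have "?O A \<le> \<nu> A"
      unfolding dtm_closed_eq_INF[OF \<nu>(1) A]
    proof (rule INF_greatest)
      fix U assume "U \<in> {U. openin X U \<and> A \<subseteq> U}"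
      then show "?O A \<le> \<nu> U" using O_le[of U] cover_outer_measure_mono[of A U X \<nu>] by auto
    qed
    then show ?thesis using em[OF sigma_sets_openin_closedin[OF A]] by simp
  qed
  then have "emeasure m (topspace X) = 0"
    using \<open>proper X \<nu>\<close> radon op[of "topspace X"] unfolding proper_def sets[symmetric] by blast
  then show ?thesis using em[OF op, of "topspace X"] by simp
qed

section \<open>Properness of superpositions\<close>

text \<open>
  The cover is chosen for \<open>\<nu>'\<close> alone, so it has to be cut into disjoint compact pieces: on overlapping members
  the values of \<open>\<nu>\<close> could add up to more than \<open>\<nu> C\<close>. Passing to pieces costs nothing for \<open>m\<close>, which is
  countably additive.
\<close>

lemma radon_measure_le_cancel_null_cover:
  assumes H: "Hausdorff_space X" and m: "radon_measure X m"
    and \<nu>: "deficient_topological_measure X \<nu>" "\<nu> (topspace X) < \<infinity>"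
    and \<nu>': "deficient_topological_measure X \<nu>'"
    and null: "cover_outer_measure X \<nu>' (topspace X) = 0"
    and le: "\<And>C. compactin X C \<Longrightarrow> emeasure m C \<le> \<nu> C + \<nu>' C"
    and C: "compactin X C"
  shows "emeasure m C \<le> \<nu> C"
proof (rule ennreal_le_epsilon)
  fix \<epsilon> :: real assume "\<epsilon> > 0"
  have "cover_outer_measure X \<nu>' (topspace X) < ennreal (\<epsilon>/2)" using null \<open>\<epsilon> > 0\<close> by simp
  then obtain U :: "nat \<Rightarrow> 'a set" where U: "\<And>j. openin X (U j)" "topspace X \<subseteq> (\<Union>j. U j)"
      "(\<Sum>j. \<nu>' (U j)) < ennreal (\<epsilon>/2)"
    unfolding cover_outer_measure_less_iff by blast
  let ?D = "disjointed (\<lambda>j. C \<inter> U j)"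
  have Cm: "C \<in> sets m" using radon_measure_sets(3)[OF H m C] .
  have "range (\<lambda>j. C \<inter> U j) \<subseteq> sets m" using Cm radon_measure_sets(1)[OF H m U(1)] by auto
  then have Dm: "range ?D \<subseteq> sets m" by (rule sets.range_disjointed_sets)
  have DC: "?D j \<subseteq> C \<inter> U j" for j by (rule disjointed_subset)
  have "\<exists>E. compactin X E \<and> E \<subseteq> ?D j \<and> emeasure m (?D j) \<le> emeasure m E + ennreal (\<epsilon>/2 * (1/2) ^ Suc j)" for j
    using Dm DC[of j] \<open>\<epsilon> > 0\<close> by (intro radon_measure_inner_compact[OF H m _ _ C]) auto
  then obtain E where E: "\<And>j. compactin X (E j)" "\<And>j. E j \<subseteq> ?D j"
      "\<And>j. emeasure m (?D j) \<le> emeasure m (E j) + ennreal (\<epsilon>/2 * (1/2) ^ Suc j)"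
    by metis
  have "disjoint_family E"
    using disjoint_family_disjointed E(2) by (rule disjoint_family_subset)
  have "(\<Union>j. ?D j) = C"
    using U(2) compactin_subset_topspace[OF C] by (auto simp: UN_disjointed_eq)
  then have "emeasure m C = (\<Sum>j. emeasure m (?D j))"
    using suminf_emeasure[OF Dm disjoint_family_disjointed] by simp
  also have "\<dots> \<le> (\<Sum>j. emeasure m (E j) + ennreal (\<epsilon>/2 * (1/2) ^ Suc j))"
    by (intro suminf_le E(3)) auto
  also have "\<dots> = (\<Sum>j. emeasure m (E j)) + ennreal (\<epsilon>/2)"
    using \<open>\<epsilon> > 0\<close> by (intro suminf_add_geometric) simp
  also have "(\<Sum>j. emeasure m (E j)) \<le> \<nu> C + ennreal (\<epsilon>/2)"
  proof (rule suminf_le_const)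
    fix n
    have "(\<Sum>j<n. emeasure m (E j)) \<le> (\<Sum>j<n. \<nu> (E j)) + (\<Sum>j<n. \<nu>' (E j))"
      using le[OF E(1)] by (simp add: sum_mono flip: sum.distrib)
    also have "(\<Sum>j<n. \<nu> (E j)) = \<nu> (\<Union>j<n. E j)"
      using \<open>disjoint_family E\<close> E(1)
      by (intro dtm_sum_disjoint_compact[OF \<nu>]) (auto simp: disjoint_family_on_def)
    also have "\<nu> (\<Union>j<n. E j) \<le> \<nu> C"
    proof (rule dtm_closed_mono[OF \<nu>(1)])
      show "closedin X (\<Union>j<n. E j)"
        using E(1) by (intro compactin_imp_closedin[OF H] compactin_Union) auto
      show "closedin X C" using compactin_imp_closedin[OF H C] .
      show "(\<Union>j<n. E j) \<subseteq> C" using E(2) DC by blast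
    qed
    also have "(\<Sum>j<n. \<nu>' (E j)) \<le> (\<Sum>j<n. \<nu>' (U j))"
    proof (rule sum_mono)
      fix j
      show "\<nu>' (E j) \<le> \<nu>' (U j)"
        using E(2)[of j] DC[of j] by (intro dtm_compact_le_open[OF \<nu>' E(1) U(1)]) auto
    qed
    also have "\<dots> \<le> (\<Sum>j. \<nu>' (U j))" by (intro sum_le_suminf) auto
    also have "\<dots> \<le> ennreal (\<epsilon>/2)" using U(3) by simp
    finally show "(\<Sum>j<n. emeasure m (E j)) \<le> \<nu> C + ennreal (\<epsilon>/2)"
      by (simp add: add_left_mono add_right_mono)
  qed simp
  finally show "emeasure m C \<le> \<nu> C + ennreal \<epsilon>"
    using \<open>\<epsilon> > 0\<close> by (simp add: add.assoc add_right_mono flip: ennreal_plus)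
qed

lemma radon_measure_le_sum_null_covers:
  fixes n :: nat
  assumes H: "Hausdorff_space X" and m: "radon_measure X m"
    and \<nu>: "\<And>i. i < n \<Longrightarrow> deficient_topological_measure X (\<nu> i)" "\<And>i. i < n \<Longrightarrow> \<nu> i (topspace X) < \<infinity>"
    and null: "\<And>i. i < n \<Longrightarrow> cover_outer_measure X (\<nu> i) (topspace X) = 0"
    and le: "\<And>C. compactin X C \<Longrightarrow> emeasure m C \<le> (\<Sum>i<n. \<nu> i C)"
  shows "compactin X C \<Longrightarrow> emeasure m C = 0"
  using \<nu> null le
proof (induction n arbitrary: C)
  case 0
  then show ?case by fastforce
next
  case (Suc n)
  have "deficient_topological_measure X (\<lambda>A. \<Sum>i<n. \<nu> i A)"
    using Suc.prems(2,3) by (intro deficient_topological_measure_sum[OF _ H]) auto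
  moreover have "(\<Sum>i<n. \<nu> i (topspace X)) < \<infinity>" using Suc.prems(3) by (auto simp: less_top)
  ultimately have "emeasure m C \<le> (\<Sum>i<n. \<nu> i C)" if "compactin X C" for C
    using radon_measure_le_cancel_null_cover[OF H m, of "\<lambda>A. \<Sum>i<n. \<nu> i A" "\<nu> n"] Suc.prems(2,4,5) that
    by simp
  then show ?case using Suc.IH[OF Suc.prems(1)] Suc.prems(2-4) by simp
qed

text \<open>
  An open cover of \<open>K\<close> becomes one of \<open>X\<close> with the same traces on \<open>K\<close> when the complement of \<open>K\<close> is added to each
  of its members.
\<close>

lemma cover_outer_measure_extend_null:
  assumes K: "closedin X K"
    and null: "cover_outer_measure (subtopology X K) \<nu> K = 0"
  shows "cover_outer_measure X (\<lambda>A. \<nu> (A \<inter> K)) (topspace X) = 0"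
proof (rule ccontr)
  assume "cover_outer_measure X (\<lambda>A. \<nu> (A \<inter> K)) (topspace X) \<noteq> 0"
  then have "cover_outer_measure (subtopology X K) \<nu> K <
      cover_outer_measure X (\<lambda>A. \<nu> (A \<inter> K)) (topspace X)"
    using null by (simp add: zero_less_iff_neq_zero)
  then obtain V :: "nat \<Rightarrow> 'a set" where V: "\<And>j. openin (subtopology X K) (V j)" "K \<subseteq> (\<Union>j. V j)"
      "(\<Sum>j. \<nu> (V j)) < cover_outer_measure X (\<lambda>A. \<nu> (A \<inter> K)) (topspace X)"
    unfolding cover_outer_measure_less_iff[of "subtopology X K"] by blast
  then obtain W where W: "\<And>j. openin X (W j)" "\<And>j. V j = W j \<inter> K"
    unfolding openin_subtopology by metis
  \<comment> \<open>added to every member, which avoids reindexing the sequence\<close>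
  let ?U = "\<lambda>j. W j \<union> (topspace X - K)"
  have "openin X (?U j)" for j using W(1) K by auto
  moreover have "topspace X \<subseteq> (\<Union>j. ?U j)" using V(2) W(2) by auto
  ultimately have "cover_outer_measure X (\<lambda>A. \<nu> (A \<inter> K)) (topspace X) \<le> (\<Sum>j. \<nu> (?U j \<inter> K))"
    by (rule cover_outer_measure_le)
  moreover have "?U j \<inter> K = V j" for j using W(2) by auto
  ultimately show False using V(3) by simp
qed

text \<open>
  Properness is assumed on each \<open>K i\<close> and concluded on \<open>X\<close>. Null covers carry it over, because they
  extend from \<open>K i\<close> to \<open>X\<close> and their summands can be cancelled.
\<close>

lemma superposition_proper:
  assumes H: "Hausdorff_space X" and K: "\<And>i. compactin X (K i)"
    and \<nu>: "\<And>i. i < n \<Longrightarrow> \<nu> i \<in> pDTM (subtopology X (K i))"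
  shows "proper X (superposition X K n \<nu>)"
  unfolding proper_def
proof (intro allI impI ballI)
  fix m A
  assume m: "radon_measure X m"
    and le: "\<forall>A\<in>open_closed_sets X. emeasure m A \<le> superposition X K n \<nu> A" and A: "A \<in> sets m"
  let ?\<nu> = "\<lambda>i A. \<nu> i (A \<inter> K i)"
  have KX: "topspace X \<inter> K i = K i" for i using compactin_subset_topspace[OF K] by blast
  have \<nu>_sub: "deficient_topological_measure (subtopology X (K i)) (\<nu> i)" "\<nu> i (K i) < \<infinity>"
    "proper (subtopology X (K i)) (\<nu> i)" if "i < n" for i
    using \<nu>[OF that] by (auto simp: pDTM_def DTM_def KX)
  have dtm: "deficient_topological_measure X (?\<nu> i)" if "i < n" for i
    by (rule deficient_topological_measure_extend[OF H K \<nu>_sub(1,2)[OF that]])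
  have null: "cover_outer_measure X (?\<nu> i) (topspace X) = 0" if "i < n" for i
    using proper_imp_null_cover[of "subtopology X (K i)" "\<nu> i"] \<nu>_sub[OF that] K[of i] H
      compactin_imp_closedin[OF H K[of i]]
    by (intro cover_outer_measure_extend_null)
      (simp_all add: KX compact_space_subtopology Hausdorff_space_subtopology)
  have "emeasure m C \<le> (\<Sum>i<n. ?\<nu> i C)" if "compactin X C" for C
  proof -
    have "C \<in> open_closed_sets X" using compactin_imp_closedin[OF H that] by (simp add: open_closed_sets_def)
    then show ?thesis using le by (auto simp: superposition_def)
  qed
  then have zero: "emeasure m C = 0" if "compactin X C" for C
    using radon_measure_le_sum_null_covers[OF H m, of n ?\<nu> C] dtm null \<nu>_sub(2) that by (simp add: KX)
  have "emeasure m (topspace X) = (SUP C\<in>{C. compactin X C \<and> C \<subseteq> topspace X}. emeasure m C)"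
    using m unfolding radon_measure_def regular_borel_measure_def by blast
  also have "\<dots> \<le> 0" using zero by (intro SUP_least) auto
  finally have "emeasure m (topspace X) = 0" by simp
  moreover have "A \<subseteq> topspace X"
    using sets.sets_into_space[OF A] m by (simp add: radon_measure_def regular_borel_measure_def)
  then have "emeasure m A \<le> emeasure m (topspace X)"
    using radon_measure_sets(1)[OF H m openin_topspace] by (intro emeasure_mono)
  ultimately show "emeasure m A = 0" by simp
qed

section \<open>Integrals of superpositions\<close>

lemma C0_nonneg_bounded:
  assumes "f \<in> C0_nonneg X"
  obtains b where "b \<ge> 0" "f ` topspace X \<subseteq> {0..b}"
proof -
  have f: "continuous_map X euclideanreal f" "\<And>x. x \<in> topspace X \<Longrightarrow> 0 \<le> f x"
    using assms by (auto simp: C0_nonneg_def)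
  obtain K where K: "compactin X K" "\<And>x. x \<in> topspace X - K \<Longrightarrow> f x < 1"
    using assms unfolding C0_nonneg_def by (auto dest!: spec[of _ 1])
  have "compact (f ` K)" using image_compactin[OF K(1) f(1)] by simp
  then obtain c where c: "\<And>x. x \<in> K \<Longrightarrow> f x \<le> c"
    using compact_imp_bounded bounded_imp_bdd_above by (metis bdd_above.unfold image_eqI)
  have "f x \<in> {0..max 1 c}" if "x \<in> topspace X" for x
    using f(2)[OF that] K(2)[of x] c[of x] that by (cases "x \<in> K") auto
  then show ?thesis by (intro that[of "max 1 c"]) auto
qed

lemma C0_nonneg_subtopology:
  assumes "f \<in> C0_nonneg X" "compactin X K"
  shows "f \<in> C0_nonneg (subtopology X K)"
proof -
  have "compactin (subtopology X K) K" using assms(2) by (simp add: compactin_subtopology)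
  then show ?thesis
    using assms(1) unfolding C0_nonneg_def
    by (auto simp: continuous_map_from_subtopology intro!: exI[of _ K])
qed

lemma openin_superlevel:
  assumes "f \<in> C0_nonneg X"
  shows "openin X {x \<in> topspace X. t < f x}"
proof -
  have "openin X {x \<in> topspace X. f x \<in> {t<..}}"
    using assms by (intro openin_continuous_map_preimage[of X euclideanreal]) (auto simp: C0_nonneg_def)
  then show ?thesis by simp
qed

text \<open>
  The integrand is antitone and bounded by \<open>\<nu> (topspace X)\<close>.
\<close>

lemma set_integrable_superlevel:
  assumes \<nu>: "\<nu> \<in> DTM X" and f: "f \<in> C0_nonneg X"
  shows "set_integrable lborel {0..b} (\<lambda>t. enn2real (\<nu> {x \<in> topspace X. t < f x}))"
proof -
  let ?U = "\<lambda>t. {x \<in> topspace X. t < f x}"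
  have dtm: "deficient_topological_measure X \<nu>" and fin: "\<nu> (topspace X) < top"
    using \<nu> by (auto simp: DTM_def)
  have le: "enn2real (\<nu> U) \<le> enn2real (\<nu> V)" if "openin X U" "openin X V" "U \<subseteq> V" for U V
    using dtm_open_mono[OF dtm that] dtm_open_mono[OF dtm that(2) openin_topspace openin_subset[OF that(2)]] fin
    by (intro enn2real_mono) auto
  have "mono (\<lambda>t. - enn2real (\<nu> (?U t)))"
    using openin_superlevel[OF f] by (auto intro!: monoI le)
  then have "(\<lambda>t. - enn2real (\<nu> (?U t))) \<in> borel_measurable borel" by (rule borel_measurable_mono)
  then have "(\<lambda>t. enn2real (\<nu> (?U t))) \<in> borel_measurable borel"
    using borel_measurable_uminus by fastforce
  moreover have "norm (enn2real (\<nu> (?U t))) \<le> enn2real (\<nu> (topspace X))" for t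
    using le[OF openin_superlevel[OF f] openin_topspace] by auto
  ultimately show ?thesis
    unfolding set_integrable_def by (intro integrableI_bounded_set_indicator) (auto simp: emeasure_lborel_Icc_eq)
qed

text \<open>
  Uniform closeness on open sets suffices because the superlevel sets of \<open>f\<close> are open.
\<close>

lemma qintegral_diff_le:
  assumes \<mu>: "\<mu> \<in> DTM X" and \<rho>: "\<rho> \<in> DTM X" and f: "f \<in> C0_nonneg X"
    and b: "0 \<le> b" "f ` topspace X \<subseteq> {0..b}"
    and close: "\<And>U. openin X U \<Longrightarrow> \<bar>enn2real (\<mu> U) - enn2real (\<rho> U)\<bar> \<le> \<delta>"
  shows "\<bar>qintegral X \<mu> f - qintegral X \<rho> f\<bar> \<le> b * \<delta>"
proof -
  let ?g = "\<lambda>\<mu> t. enn2real (\<mu> {x \<in> topspace X. t < f x})"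
  have int: "set_integrable lborel {0..b} (\<lambda>t. ?g \<mu> t - ?g \<rho> t)"
    using set_integrable_superlevel[OF \<mu> f] set_integrable_superlevel[OF \<rho> f] by (rule set_integral_diff)
  have "qintegral X \<mu> f - qintegral X \<rho> f = (LINT t:{0..b}|lborel. ?g \<mu> t - ?g \<rho> t)"
    unfolding qintegral_eq[OF \<mu> b(2)] qintegral_eq[OF \<rho> b(2)]
    using set_integrable_superlevel[OF \<mu> f] set_integrable_superlevel[OF \<rho> f]
    by (rule set_integral_diff(2)[symmetric])
  then have "\<bar>qintegral X \<mu> f - qintegral X \<rho> f\<bar> \<le> (LINT t:{0..b}|lborel. \<bar>?g \<mu> t - ?g \<rho> t\<bar>)"
    using set_integral_norm_bound[OF int] by simp
  also have "\<dots> \<le> (LINT t:{0..b}|lborel. \<delta>)"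
  proof (rule set_integral_mono)
    show "set_integrable lborel {0..b} (\<lambda>t. \<bar>?g \<mu> t - ?g \<rho> t\<bar>)" using int by (rule set_integrable_abs)
    show "set_integrable lborel {0..b} (\<lambda>t. \<delta>)" 
      unfolding set_integrable_def
      by (rule integrableI_bounded_set_indicator[where B = "\<bar>\<delta>\<bar>"]) (auto simp: emeasure_lborel_Icc_eq)
    show "\<bar>?g \<mu> t - ?g \<rho> t\<bar> \<le> \<delta>" for t by (rule close[OF openin_superlevel[OF f]])
  qed
  also have "\<dots> = b * \<delta>" using b(1) by (simp add: set_integral_const)
  finally show ?thesis .
qed

text \<open>
  The trace of a superlevel set on \<open>K i\<close> is a superlevel set of the restriction of \<open>f\<close>. A common upper limit of integration is used
  for all \<open>K i\<close>, whose suprema of \<open>f\<close> may differ.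
\<close>

lemma qintegral_superposition:
  assumes H: "Hausdorff_space X" and K: "\<And>i. compactin X (K i)"
    and \<nu>: "\<And>i. i < n \<Longrightarrow> \<nu> i \<in> DTM (subtopology X (K i))" and f: "f \<in> C0_nonneg X"
  shows "qintegral X (superposition X K n \<nu>) f = (\<Sum>i<n. qintegral (subtopology X (K i)) (\<nu> i) f)"
proof -
  obtain b where b: "f ` topspace X \<subseteq> {0..b}" using C0_nonneg_bounded[OF f] by blast
  let ?g = "\<lambda>i t. enn2real (\<nu> i {x \<in> topspace (subtopology X (K i)). t < f x})"
  have int: "set_integrable lborel {0..b} (?g i)" if "i < n" for i
    using \<nu>[OF that] C0_nonneg_subtopology[OF f K] by (rule set_integrable_superlevel)
  have level: "enn2real (superposition X K n \<nu> {x \<in> topspace X. t < f x}) = (\<Sum>i<n. ?g i t)" for t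
  proof -
    have "{x \<in> topspace X. t < f x} \<in> open_closed_sets X"
      using openin_superlevel[OF f] by (simp add: open_closed_sets_def)
    moreover have tr: "{x \<in> topspace X. t < f x} \<inter> K i = {x \<in> topspace (subtopology X (K i)). t < f x}" for i
      by auto
    moreover have "\<nu> i {x \<in> topspace (subtopology X (K i)). t < f x} < top" if "i < n" for i
    proof -
      have o: "openin (subtopology X (K i)) {x \<in> topspace (subtopology X (K i)). t < f x}"
        by (rule openin_superlevel[OF C0_nonneg_subtopology[OF f K]])
      have "deficient_topological_measure (subtopology X (K i)) (\<nu> i)"
        "\<nu> i (topspace (subtopology X (K i))) < top"
        using \<nu>[OF that] by (simp_all add: DTM_def)
      then show ?thesis
        using dtm_open_mono[OF _ o openin_topspace openin_subset[OF o]] by (meson le_less_trans)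
    qed
    then have "enn2real (\<Sum>i<n. \<nu> i {x \<in> topspace (subtopology X (K i)). t < f x}) = (\<Sum>i<n. ?g i t)"
      by (subst enn2real_sum) (simp_all only: lessThan_iff comp_def)
    ultimately show ?thesis by (simp only: superposition_def restrict_apply' tr)
  qed
  have "superposition X K n \<nu> \<in> DTM X" using \<nu> by (rule superposition_in_DTM[OF H K])
  then have "qintegral X (superposition X K n \<nu>) f = (LINT t:{0..b}|lborel. (\<Sum>i<n. ?g i t))"
    using b by (simp only: qintegral_eq level)
  also have "\<dots> = (\<Sum>i<n. LINT t:{0..b}|lborel. ?g i t)"
    using int unfolding set_lebesgue_integral_def set_integrable_def scaleR_sum_right
    by (intro Bochner_Integration.integral_sum) auto
  also have "\<dots> = (\<Sum>i<n. qintegral (subtopology X (K i)) (\<nu> i) f)"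
    using b by (intro sum.cong refl qintegral_eq[OF \<nu>, symmetric]) auto
  finally show ?thesis .
qed

section \<open>Density\<close>

text \<open>
  The measures are the pieces of \<open>m\<close> on the disjointed sets \<open>B i \<subseteq> K i\<close>. Their sum is \<open>m\<close> restricted to
  \<open>\<Union>i<n. K i\<close>, and continuity from below makes the remaining mass small.
\<close>

lemma finite_regular_measure_superposition_approx:
  fixes K :: "nat \<Rightarrow> 'a set"
  assumes H: "Hausdorff_space X" and K: "\<And>i. compactin X (K i)" and cover: "topspace X = (\<Union>i. K i)"
    and \<mu>: "\<mu> \<in> finite_regular_measures X" and "\<delta> > 0"
  obtains n \<rho> where "\<And>i. i < n \<Longrightarrow> \<rho> i \<in> finite_regular_measures (subtopology X (K i))"
    "\<And>U. openin X U \<Longrightarrow> \<bar>enn2real (superposition X K n \<rho> U) - enn2real (\<mu> U)\<bar> \<le> \<delta>"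
proof -
  obtain m where \<mu>_def: "\<mu> = restrict (emeasure m) (open_closed_sets X)"
    and m: "regular_borel_measure X m" "emeasure m (topspace X) < \<infinity>"
    using \<mu> by (auto simp: finite_regular_measures_def)
  have sp: "space m = topspace X" and sets: "sets m = sigma_sets (topspace X) {U. openin X U}"
    using m(1) by (auto simp: regular_borel_measure_def)
  have fin: "emeasure m A \<noteq> \<infinity>" for A
    using emeasure_space[of m A] m(2) by (auto simp: sp top_unique)
  have Km: "K i \<in> sets m" for i
    unfolding sets by (rule sigma_sets_openin_closedin[OF compactin_imp_closedin[OF H K]])
  let ?A = "\<lambda>n. \<Union>i<n. K i" and ?B = "disjointed K"
  have Am: "?A n \<in> sets m" for n using Km by auto
  have "incseq ?A" by (intro monoI UN_mono) auto
  then have "(SUP n. emeasure m (?A n)) = emeasure m (\<Union>n. ?A n)"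
    using Am by (intro SUP_emeasure_incseq) auto
  also have "(\<Union>n. ?A n) = topspace X" unfolding cover by auto
  finally obtain n where n: "emeasure m (topspace X) < emeasure m (?A n) + ennreal \<delta>"
    using SUP_approx_ennreal[OF \<open>\<delta> > 0\<close>, of UNIV "emeasure m (topspace X)" "\<lambda>n. emeasure m (?A n)"] fin
    by auto
  let ?\<rho> = "\<lambda>i. restrict (\<lambda>A. emeasure m (A \<inter> ?B i)) (open_closed_sets (subtopology X (K i)))"
  have B: "?B i \<in> sets m" "?B i \<subseteq> K i" for i
    using sets.range_disjointed_sets[of K m] Km disjointed_subset[of K i] by auto
  have \<rho>: "?\<rho> i \<in> finite_regular_measures (subtopology X (K i))" for i
    by (rule restrict_to_compact_in_finite_regular_measures[OF H K m B])
  have close: "\<bar>enn2real (superposition X K n ?\<rho> U) - enn2real (\<mu> U)\<bar> \<le> \<delta>" if U: "openin X U" for U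
  proof -
    have Um: "U \<in> sets m" using U by (auto simp: sets)
    have "superposition X K n ?\<rho> U = (\<Sum>i<n. emeasure m (U \<inter> ?B i))"
    proof -
      have "U \<inter> K i \<in> open_closed_sets (subtopology X (K i))" for i
        using U by (auto simp: open_closed_sets_def openin_subtopology)
      moreover have "U \<inter> K i \<inter> ?B i = U \<inter> ?B i" for i using B(2) by auto
      moreover have "U \<in> open_closed_sets X" using U by (simp add: open_closed_sets_def)
      ultimately show ?thesis by (simp add: superposition_def)
    qed
    also have "\<dots> = emeasure m (\<Union>i<n. U \<inter> ?B i)"
      using Um B(1) disjoint_family_disjointed[of K]
      by (intro sum_emeasure) (auto simp: disjoint_family_on_def)
    also have "(\<Union>i<n. U \<inter> ?B i) = U \<inter> ?A n"
      using finite_UN_disjointed_eq[of K n] by (auto simp: lessThan_atLeast0)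
    finally have \<rho>U: "superposition X K n ?\<rho> U = emeasure m (U \<inter> ?A n)" .
    have \<mu>U: "\<mu> U = emeasure m U" using U by (simp add: \<mu>_def open_closed_sets_def)
    have "emeasure m (topspace X) = emeasure m (?A n) + emeasure m (topspace X - ?A n)"
      using Am[of n] sets.top[of m] cover
      by (subst plus_emeasure) (auto simp: sp intro!: arg_cong[of _ _ "emeasure m"])
    then have small: "emeasure m (topspace X - ?A n) \<le> ennreal \<delta>"
      using n fin[of "?A n"] by (metis ennreal_add_left_cancel_less infinity_ennreal_def less_imp_le)
    have "emeasure m U = emeasure m (U \<inter> ?A n) + emeasure m (U - ?A n)"
      using Um Am[of n] by (subst plus_emeasure) (auto intro!: arg_cong[of _ _ "emeasure m"])
    also have "\<dots> \<le> emeasure m (U \<inter> ?A n) + ennreal \<delta>"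
      using openin_subset[OF U] Am[of n] sets.top[of m]
      by (intro add_left_mono order_trans[OF emeasure_mono small]) (auto simp: sp)
    finally have "emeasure m U \<le> emeasure m (U \<inter> ?A n) + ennreal \<delta>" .
    then have "enn2real (emeasure m U) \<le> enn2real (emeasure m (U \<inter> ?A n) + ennreal \<delta>)"
      using fin by (intro enn2real_mono) (auto simp: less_top)
    also have "\<dots> = enn2real (emeasure m (U \<inter> ?A n)) + \<delta>"
      using fin \<open>\<delta> > 0\<close> by (subst enn2real_plus) (auto simp: less_top)
    finally have "enn2real (emeasure m U) \<le> enn2real (emeasure m (U \<inter> ?A n)) + \<delta>" .
    moreover have "enn2real (emeasure m (U \<inter> ?A n)) \<le> enn2real (emeasure m U)"
      using Um fin by (intro enn2real_mono emeasure_mono) (auto simp: less_top)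
    ultimately show ?thesis unfolding \<rho>U \<mu>U by linarith
  qed
  show ?thesis using \<rho> close by (rule that)
qed

text \<open>
  The common core of both parts. Half of \<open>\<epsilon>\<close> is spent on replacing \<open>\<mu>\<close> by a superposition of measures, with a
  bound \<open>\<delta>\<close> that absorbs the size of the test functions, and half on replacing the \<open>n\<close> measures by elements
  of the sets \<open>Y i\<close>.
\<close>

lemma weakly_dense_superposition:
  fixes K :: "nat \<Rightarrow> 'a set"
  assumes H: "Hausdorff_space X" and K: "\<And>i. compactin X (K i)" and cover: "topspace X = (\<Union>i. K i)"
    and dense: "\<And>i. weakly_dense_in (subtopology X (K i)) (Y i) (finite_regular_measures (subtopology X (K i)))"
    and Y: "\<And>n \<nu>. (\<And>i. i < n \<Longrightarrow> \<nu> i \<in> Y i) \<Longrightarrow> superposition X K n \<nu> \<in> Z"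
  shows "weakly_dense_in X Z (finite_regular_measures X)"
  unfolding weakly_dense_in_iff[OF finite_regular_measures_subset_DTM[OF H]]
proof (intro ballI allI impI)
  fix \<mu> F and \<epsilon> :: real
  assume \<mu>: "\<mu> \<in> finite_regular_measures X" and F: "finite F" "F \<subseteq> C0_nonneg X" and "\<epsilon> > 0"
  note M_DTM = subsetD[OF finite_regular_measures_subset_DTM]
  have "\<forall>f\<in>F. \<exists>b\<ge>0. f ` topspace X \<subseteq> {0..b}"
    using C0_nonneg_bounded F(2) by (meson subsetD)
  then obtain b where b: "\<And>f. f \<in> F \<Longrightarrow> 0 \<le> b f \<and> f ` topspace X \<subseteq> {0..b f}" by metis
  \<comment> \<open>the summand 1 keeps the denominator positive, also for an empty family of test functions\<close>
  define \<delta> where "\<delta> = \<epsilon> / (2 * (1 + (\<Sum>f\<in>F. b f)))"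
  have "(\<Sum>f\<in>F. b f) \<ge> 0" using b by (intro sum_nonneg) auto
  then have "\<delta> > 0" using \<open>\<epsilon> > 0\<close> by (simp add: \<delta>_def)
  obtain n \<rho> where \<rho>: "\<And>i. i < n \<Longrightarrow> \<rho> i \<in> finite_regular_measures (subtopology X (K i))"
    "\<And>U. openin X U \<Longrightarrow> \<bar>enn2real (superposition X K n \<rho> U) - enn2real (\<mu> U)\<bar> \<le> \<delta>"
    using finite_regular_measure_superposition_approx[OF H K cover \<mu> \<open>\<delta> > 0\<close>] by blast
  have HK: "Hausdorff_space (subtopology X (K i))" for i using H by (rule Hausdorff_space_subtopology)
  have \<rho>_DTM: "\<rho> i \<in> DTM (subtopology X (K i))" if "i < n" for i using M_DTM[OF HK \<rho>(1)[OF that]] .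
  have "\<exists>\<nu>\<in>Y i \<inter> DTM (subtopology X (K i)). \<forall>f\<in>F.
      \<bar>qintegral (subtopology X (K i)) \<nu> f - qintegral (subtopology X (K i)) (\<rho> i) f\<bar> < \<epsilon> / (2 * real n)"
    if "i < n" for i
  proof -
    have "F \<subseteq> C0_nonneg (subtopology X (K i))" using F(2) C0_nonneg_subtopology[OF _ K] by blast
    moreover have "\<epsilon> / (2 * real n) > 0" using that \<open>\<epsilon> > 0\<close> by simp
    ultimately show ?thesis
      using dense[of i] \<rho>(1)[OF that] F(1)
      unfolding weakly_dense_in_iff[OF finite_regular_measures_subset_DTM[OF HK]] by blast
  qed
  then obtain \<nu> where \<nu>: "\<And>i. i < n \<Longrightarrow> \<nu> i \<in> Y i" "\<And>i. i < n \<Longrightarrow> \<nu> i \<in> DTM (subtopology X (K i))"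
    "\<And>i f. i < n \<Longrightarrow> f \<in> F \<Longrightarrow>
      \<bar>qintegral (subtopology X (K i)) (\<nu> i) f - qintegral (subtopology X (K i)) (\<rho> i) f\<bar> < \<epsilon> / (2 * real n)"
    by (metis IntE)
  have "\<bar>qintegral X (superposition X K n \<nu>) f - qintegral X \<mu> f\<bar> < \<epsilon>" if f: "f \<in> F" for f
  proof -
    have fC0: "f \<in> C0_nonneg X" using f F(2) by blast
    have "b f * \<delta> < \<epsilon> / 2"
    proof -
      have "b f < 1 + (\<Sum>f\<in>F. b f)" using member_le_sum[of f F b] f b F(1) by fastforce
      then have "b f * \<delta> < (1 + (\<Sum>f\<in>F. b f)) * \<delta>" using \<open>\<delta> > 0\<close> by (rule mult_strict_right_mono)
      also have "\<dots> = \<epsilon> / 2" using \<open>(\<Sum>f\<in>F. b f) \<ge> 0\<close> by (simp add: \<delta>_def field_simps)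
      finally show ?thesis .
    qed
    moreover have "\<bar>qintegral X (superposition X K n \<rho>) f - qintegral X \<mu> f\<bar> \<le> b f * \<delta>"
      using b[OF f] \<rho>(2)
      by (intro qintegral_diff_le[OF superposition_in_DTM[OF H K \<rho>_DTM] M_DTM[OF H \<mu>] fC0]) auto
    moreover have "\<bar>qintegral X (superposition X K n \<nu>) f - qintegral X (superposition X K n \<rho>) f\<bar> \<le> \<epsilon> / 2"
    proof -
      have "\<bar>qintegral X (superposition X K n \<nu>) f - qintegral X (superposition X K n \<rho>) f\<bar> =
          \<bar>\<Sum>i<n. qintegral (subtopology X (K i)) (\<nu> i) f - qintegral (subtopology X (K i)) (\<rho> i) f\<bar>"
        by (simp add: qintegral_superposition[OF H K \<nu>(2) fC0] qintegral_superposition[OF H K \<rho>_DTM fC0]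
            sum_subtractf)
      also have "\<dots> \<le> (\<Sum>i<n. \<epsilon> / (2 * real n))"
        using \<nu>(3)[OF _ f] by (intro order_trans[OF sum_abs] sum_mono less_imp_le) auto
      also have "\<dots> \<le> \<epsilon> / 2" using \<open>\<epsilon> > 0\<close> by (cases "n = 0") auto
      finally show ?thesis .
    qed
    ultimately show ?thesis by linarith
  qed
  moreover have "superposition X K n \<nu> \<in> Z" using \<nu>(1) by (rule Y)
  moreover have "superposition X K n \<nu> \<in> DTM X" using \<nu>(2) by (rule superposition_in_DTM[OF H K])
  ultimately show "\<exists>\<nu>\<in>Z \<inter> DTM X. \<forall>f\<in>F. \<bar>qintegral X \<nu> f - qintegral X \<mu> f\<bar> < \<epsilon>" by blast
qed

theorem theorem52:
  fixes X :: "'a topology" and K :: "nat \<Rightarrow> 'a set"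
  assumes "locally_compact_space X" and "Hausdorff_space X"
    and "\<And>i. compactin X (K i)"
    and "topspace X = (\<Union>i. K i)"
  shows
    "((\<forall>i. weakly_dense_in (subtopology X (K i))
            (pDTM (subtopology X (K i))) (finite_regular_measures (subtopology X (K i))))
        \<longrightarrow> weakly_dense_in X (pDTM X) (finite_regular_measures X))
     \<and>
     ((\<forall>i. weakly_dense_in (subtopology X (K i))
            (pTM (subtopology X (K i))) (finite_regular_measures (subtopology X (K i))))
        \<longrightarrow> weakly_dense_in X (pTM X) (finite_regular_measures X))"
proof (intro conjI impI)
  assume "\<forall>i. weakly_dense_in (subtopology X (K i))
            (pDTM (subtopology X (K i))) (finite_regular_measures (subtopology X (K i)))"
  then show "weakly_dense_in X (pDTM X) (finite_regular_measures X)"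
  proof (intro weakly_dense_superposition[OF assms(2-4), where Y = "\<lambda>i. pDTM (subtopology X (K i))"])
    fix n \<nu> assume \<nu>: "\<And>i. i < n \<Longrightarrow> \<nu> i \<in> pDTM (subtopology X (K i))"
    have "superposition X K n \<nu> \<in> DTM X"
      using \<nu> by (intro superposition_in_DTM[OF assms(2,3)]) (auto simp: pDTM_def)
    then show "superposition X K n \<nu> \<in> pDTM X"
      using superposition_proper[OF assms(2,3) \<nu>] by (simp add: pDTM_def)
  qed simp
next
  assume "\<forall>i. weakly_dense_in (subtopology X (K i))
            (pTM (subtopology X (K i))) (finite_regular_measures (subtopology X (K i)))"
  then show "weakly_dense_in X (pTM X) (finite_regular_measures X)"
  proof (intro weakly_dense_superposition[OF assms(2-4), where Y = "\<lambda>i. pTM (subtopology X (K i))"])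
    fix n \<nu> assume \<nu>: "\<And>i. i < n \<Longrightarrow> \<nu> i \<in> pTM (subtopology X (K i))"
    then have "\<nu> i \<in> pDTM (subtopology X (K i))" if "i < n" for i
      using that TM_subset_DTM by (auto simp: pTM_def pDTM_def)
    then have "proper X (superposition X K n \<nu>)"
      by (rule superposition_proper[OF assms(2,3)])
    moreover have "superposition X K n \<nu> \<in> TM X"
      using \<nu> by (intro superposition_in_TM[OF assms(2,3)]) (auto simp: pTM_def)
    ultimately show "superposition X K n \<nu> \<in> pTM X" by (simp add: pTM_def)
  qed simp
qed

end
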